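(* Let $\ell\ge2$, let $\Phi$ be a root system of type $B_\ell$, and let $\omega\in W_{A_\circ} = \{1,\omega_1\}$. Then for every $q\in\mathbb{Z}_{>0}$, $$\chi_{\Phi,q}(\omega) = \begin{cases} (q-1)(q-3)\cdots(q-(2\ell-1)) & \text{if }\omega=1\text{ and }q\notin2\mathbb{Z},\\ (q-2)(q-4)\cdots(q-2(\ell-1))\,(q-\ell) & \text{if }\omega=1\text{ and }q\in2\mathbb{Z},\\ 0 & \text{if }\omega=\omega_1\text{ and }q\notin2\mathbb{Z},\\ (q-2)(q-4)\cdots(q-2(\ell-1)) & \text{if }\omega=\omega_1\text{ and }q\in2\mathbb{Z}.\end{cases}$$
   Context: Let $\Phi = \{\pm e_i\pm e_k\ (i<k),\ \pm e_k\}\subset E=\mathbb{R}^\ell$, with simple roots $\alpha_i=e_i-e_{i+1}$ ($1\le i\le\ell-1$), $\alpha_\ell=e_\ell$, Weyl group $W$ and the standard inner product $(\cdot,\cdot)$. The coweight lattice is $Z := \{x\in E : (\alpha,x)\in\mathbb{Z}\ \forall\alpha\in\Phi\}$. For $q\in\mathbb{Z}_{>0}$, $M(\Phi;q) := \{x+qZ\in Z/qZ : (\beta,x)\not\equiv0\pmod q\ \forall\beta\in\Phi\}$; $W$ acts on it via $w(x+qZ)=w(x)+qZ$, and $\chi_{\Phi,q}(w) := \#\{t\in M(\Phi;q) : w(t)=t\}$. Let $\tilde\alpha=\sum_{i=1}^\ell n_i\alpha_i$ be the highest root, $n_0:=1$, $J:=\{i\in\{0,\dots,\ell\}: n_i=1\}$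 (here $J=\{0,1\}$). Let $w_0$ be the longest element of $W$; for $j\in J\setminus\{0\}$ let $w_j$ be the longest element of the subgroup generated by the simple reflections $s_{\alpha_i}$, $i\ne j$; put $\omega_j := w_jw_0$ and $\omega_0:=1$. Let $A_\circ=\{x\in E : (\alpha_i,x)>0\ \forall i,\ (\tilde\alpha,x)<1\}$; $W_{A_\circ}$ is the subgroup of $w\in W$ mapping the image of $A_\circ$ in $E/Z$ to itself, and $W_{A_\circ}=\{\omega_j : j\in J\}$. *)

theory Defs
  imports "HOL-Analysis.Analysis" "HOL-Algebra.Bij" "HOL-Algebra.Generated_Groups"
begin

section \<open>Characteristic quasi-polynomials of a root system\<close>

text \<open>The ambient Euclidean space \<open>E\<close> is a type \<open>'a\<close>, with its inner product. A root system is a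
  set \<open>\<Phi>\<close> of vectors, and its simple roots are \<open>\<alpha> 1, \<dots>, \<alpha> l\<close>. Weyl group elements are maps
  \<open>E \<Rightarrow> E\<close>; the group operation is composition.\<close>

definition reflection :: "'a::real_inner \<Rightarrow> 'a \<Rightarrow> 'a" where
  "reflection a x = x - (2 * (a \<bullet> x) / (a \<bullet> a)) *\<^sub>R a"

definition weyl_group :: "'a::real_inner set \<Rightarrow> ('a \<Rightarrow> 'a) set" where
  "weyl_group \<Phi> = generate (BijGroup UNIV) (reflection ` \<Phi>)"

definition coweight_lattice :: "'a::real_inner set \<Rightarrow> 'a set" where
  "coweight_lattice \<Phi> = {x. \<forall>a\<in>\<Phi>. a \<bullet> x \<in> \<int>}"

definition coset_mod :: "'a::real_inner set \<Rightarrow> nat \<Rightarrow> 'a \<Rightarrow> 'a set" where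
  "coset_mod Z q x = (+) x ` ((*\<^sub>R) (real q) ` Z)"

definition regular_cosets :: "'a::real_inner set \<Rightarrow> nat \<Rightarrow> 'a set set" where
  "regular_cosets \<Phi> q =
     coset_mod (coweight_lattice \<Phi>) q `
       {x \<in> coweight_lattice \<Phi>. \<forall>b\<in>\<Phi>. \<not> (\<exists>k::int. b \<bullet> x = real q * of_int k)}"

text \<open>A Weyl group element \<open>w\<close> is linear and permutes the coweight lattice \<open>Z\<close>, so the image of the
  set \<open>x + qZ\<close> under \<open>w\<close> is the coset \<open>w x + qZ\<close>: the action on cosets is taking images.\<close>

definition char_count :: "'a::real_inner set \<Rightarrow> nat \<Rightarrow> ('a \<Rightarrow> 'a) \<Rightarrow> nat" where
  "char_count \<Phi> q w = card {t \<in> regular_cosets \<Phi> q. w ` t = t}"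

definition simple_reflections :: "(nat \<Rightarrow> 'a::real_inner) \<Rightarrow> nat set \<Rightarrow> ('a \<Rightarrow> 'a) set" where
  "simple_reflections \<alpha> I = (\<lambda>i. reflection (\<alpha> i)) ` I"

definition word_length :: "('a \<Rightarrow> 'a) set \<Rightarrow> ('a \<Rightarrow> 'a) \<Rightarrow> nat" where
  "word_length S w = (LEAST n. \<exists>ss. length ss = n \<and> set ss \<subseteq> S \<and> foldr (\<circ>) ss id = w)"

text \<open>The element of the subgroup \<open>G\<close> of greatest length, where lengths are taken with respect to
  the generators \<open>S\<close> of the whole group.\<close>

definition longest_element :: "('a \<Rightarrow> 'a) set \<Rightarrow> ('a \<Rightarrow> 'a) set \<Rightarrow> ('a \<Rightarrow> 'a)" where
  "longest_element S G = (THE w. w \<in> G \<and> (\<forall>v\<in>G. word_length S v \<le> word_length S w))"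

text \<open>For \<open>j \<noteq> 0\<close> this is used only for \<open>j\<close> whose simple root has coefficient \<open>1\<close> in the highest
  root.\<close>

definition omega :: "'a::real_inner set \<Rightarrow> (nat \<Rightarrow> 'a) \<Rightarrow> nat \<Rightarrow> nat \<Rightarrow> ('a \<Rightarrow> 'a)" where
  "omega \<Phi> \<alpha> l j =
     (if j = 0 then id
      else longest_element (simple_reflections \<alpha> {1..l})
             (generate (BijGroup UNIV) (simple_reflections \<alpha> ({1..l} - {j})))
           \<circ> longest_element (simple_reflections \<alpha> {1..l}) (weyl_group \<Phi>))"

definition highest_root :: "'a::real_inner set \<Rightarrow> (nat \<Rightarrow> 'a) \<Rightarrow> nat \<Rightarrow> 'a" where
  "highest_root \<Phi> \<alpha> l =
     (THE b. b \<in> \<Phi> \<and> (\<forall>c\<in>\<Phi>. \<exists>n :: nat \<Rightarrow> nat. b - c = (\<Sum>i=1..l. real (n i) *\<^sub>R \<alpha> i)))"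

definition fund_alcove :: "'a::real_inner set \<Rightarrow> (nat \<Rightarrow> 'a) \<Rightarrow> nat \<Rightarrow> 'a set" where
  "fund_alcove \<Phi> \<alpha> l = {x. (\<forall>i\<in>{1..l}. \<alpha> i \<bullet> x > 0) \<and> highest_root \<Phi> \<alpha> l \<bullet> x < 1}"

text \<open>The image of the fundamental alcove in \<open>E/Z\<close>, as a set of cosets, and its stabilizer in the
  Weyl group.\<close>

definition alcove_image :: "'a::real_inner set \<Rightarrow> (nat \<Rightarrow> 'a) \<Rightarrow> nat \<Rightarrow> 'a set set" where
  "alcove_image \<Phi> \<alpha> l = coset_mod (coweight_lattice \<Phi>) 1 ` fund_alcove \<Phi> \<alpha> l"

definition alcove_stabilizer ::
  "'a::real_inner set \<Rightarrow> (nat \<Rightarrow> 'a) \<Rightarrow> nat \<Rightarrow> ('a \<Rightarrow> 'a) set" where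
  "alcove_stabilizer \<Phi> \<alpha> l =
     {w \<in> weyl_group \<Phi>. (\<lambda>t. w ` t) ` alcove_image \<Phi> \<alpha> l = alcove_image \<Phi> \<alpha> l}"

section \<open>Type B\<close>

text \<open>Here \<open>e 1, \<dots>, e l\<close> is the standard basis of the \<open>l\<close>-dimensional space \<open>E\<close>.\<close>

definition B_roots :: "(nat \<Rightarrow> 'a::real_inner) \<Rightarrow> nat \<Rightarrow> 'a set" where
  "B_roots e l =
     {s *\<^sub>R e i + t *\<^sub>R e k | s t i k. s \<in> {1, -1} \<and> t \<in> {1, -1} \<and> 1 \<le> i \<and> i < k \<and> k \<le> l}
     \<union> {s *\<^sub>R e k | s k. s \<in> {1, -1} \<and> 1 \<le> k \<and> k \<le> l}"

definition B_simple :: "(nat \<Rightarrow> 'a::real_inner) \<Rightarrow> nat \<Rightarrow> nat \<Rightarrow> 'a" where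
  "B_simple e l i = (if i < l then e i - e (i + 1) else e l)"

end

theory Submission
  imports Defs
begin

text \<open>Everything is read off coordinates \<open>x\<^sub>k = e k \<bullet> x\<close>. The Weyl group consists of all signed
  permutations of the coordinates, the coweight lattice consists of the integer vectors, and a coset
  is regular when its residues modulo \<open>q\<close> are nonzero and no two of them are equal or opposite.

  The element \<open>\<omega>\<^sub>1\<close> is a product of two longest elements, and these are pinned down by one device:
  evaluate a signed permutation \<open>w\<close> at the vector \<open>\<rho> = (l, l - 1, \<dots>, 1)\<close>, which has inner product
  1 with every simple root. The word length of \<open>w\<close> is the number of positive roots that are
  negative on \<open>w \<rho>\<close> (\<open>word_length_eq_inversions\<close>), and \<open>w\<close> is the identity as soon as all simple
  roots are positive on \<open>w \<rho>\<close> (\<open>dominant_imp_id\<close>). If \<open>w\<close> fixes the first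
  \<open>m - 1\<close> basis vectors, it is enough to test the simple roots from the \<open>m\<close>-th one on. These \<open>w\<close> form
  the subgroup generated by the corresponding simple reflections, and its longest element is
  the map that makes the most positive roots negative, namely the sign change in the coordinates
  from \<open>m\<close> on (\<open>longest_element_parabolic\<close>). The cases \<open>m = 2\<close> and \<open>m = 1\<close> give
  \<open>\<omega>\<^sub>1\<close>: it changes the sign of the first coordinate only.

  The alcove is \<open>x\<^sub>1 > \<dots> > x\<^sub>l > 0\<close>, \<open>x\<^sub>1 + x\<^sub>2 < 1\<close>. The affine map \<open>x\<^sub>1 \<mapsto> 1 - x\<^sub>1\<close> preserves it and
  agrees with \<open>\<omega>\<^sub>1\<close> modulo the lattice, so \<open>\<omega>\<^sub>1\<close> stabilizes its image. Conversely, an element of the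
  stabilizer moves the center \<open>\<rho> / (2 l)\<close> of the alcove to a vector that is congruent to a vector of
  the alcove; the coordinates are so small that this vector or its image under \<open>\<omega>\<^sub>1\<close> lies in the
  alcove itself, and then \<open>dominant_imp_id\<close> applies (\<open>alcove_stabilizer_eq\<close>).

  What remains is counting lists of \<open>l\<close> nonzero residues, each new entry avoiding the earlier ones
  and their negatives. For odd \<open>q\<close> negation has no fixed point among the \<open>q - 1\<close> nonzero residues, so
  every choice removes exactly two candidates for the later ones. For even \<open>q\<close> the fixed point
  \<open>q / 2\<close> may occur once, which explains the factor \<open>q - l\<close>. A coset is fixed by \<open>\<omega>\<^sub>1\<close> iff
  its first residue is its own negative, that is, equal to \<open>q / 2\<close>; for odd \<open>q\<close> there is none.\<close>

section \<open>Lists that avoid repetitions up to an involution\<close>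

definition avoiding_lists :: "('b \<Rightarrow> 'b) \<Rightarrow> 'b set \<Rightarrow> nat \<Rightarrow> 'b list set" where
  "avoiding_lists \<sigma> A n =
    {xs. length xs = n \<and> set xs \<subseteq> A \<and> sorted_wrt (\<lambda>x y. y \<noteq> x \<and> y \<noteq> \<sigma> x) xs}"

lemma avoiding_lists_0: "avoiding_lists \<sigma> A 0 = {[]}"
  by (auto simp: avoiding_lists_def)

lemma Cons_avoiding_lists:
  "x # xs \<in> avoiding_lists \<sigma> A (Suc n) \<longleftrightarrow> x \<in> A \<and> xs \<in> avoiding_lists \<sigma> (A - {x, \<sigma> x}) n"
  by (auto simp: avoiding_lists_def)

lemma avoiding_lists_Suc:
  "avoiding_lists \<sigma> A (Suc n) = (\<Union>x\<in>A. (#) x ` avoiding_lists \<sigma> (A - {x, \<sigma> x}) n)"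
proof (rule Set.set_eqI)
  fix ys
  show "ys \<in> avoiding_lists \<sigma> A (Suc n)
      \<longleftrightarrow> ys \<in> (\<Union>x\<in>A. (#) x ` avoiding_lists \<sigma> (A - {x, \<sigma> x}) n)"
  proof (cases ys)
    case Nil
    then show ?thesis by (auto simp: avoiding_lists_def)
  next
    case (Cons x xs)
    then show ?thesis by (auto simp: Cons_avoiding_lists)
  qed
qed

lemma finite_avoiding_lists: "finite A \<Longrightarrow> finite (avoiding_lists \<sigma> A n)"
  by (rule finite_subset[OF _ finite_lists_length_eq[of A n]]) (auto simp: avoiding_lists_def)

lemma card_avoiding_lists_Suc:
  assumes "finite A"
  shows "card (avoiding_lists \<sigma> A (Suc n)) = (\<Sum>x\<in>A. card (avoiding_lists \<sigma> (A - {x, \<sigma> x}) n))"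
  unfolding avoiding_lists_Suc
  by (subst card_UN_disjoint) (auto simp: assms finite_avoiding_lists card_image)

text \<open>An entry \<open>x\<close> excludes the two values \<open>x\<close> and \<open>\<sigma> x\<close> from the rest of the list, and the remaining
  values are again closed under \<open>\<sigma>\<close>. The product is taken over the integers, and it vanishes if the
  values run out: \<open>card A\<close> is even, so a factor is then zero.\<close>

lemma card_avoiding_lists_free:
  assumes "finite A" "\<And>x. x \<in> A \<Longrightarrow> \<sigma> x \<in> A \<and> \<sigma> (\<sigma> x) = x \<and> \<sigma> x \<noteq> x"
  shows "int (card (avoiding_lists \<sigma> A n)) = (\<Prod>k<n. int (card A) - 2 * int k)"
  using assms
proof (induction n arbitrary: A)
  case 0
  then show ?case by (simp add: avoiding_lists_0)
next
  case (Suc n)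
  have step: "int (card (avoiding_lists \<sigma> (A - {x, \<sigma> x}) n))
      = (\<Prod>k<n. int (card A) - 2 * int (Suc k))" if x: "x \<in> A" for x
  proof -
    have sx: "\<sigma> x \<in> A" "\<sigma> (\<sigma> x) = x" "\<sigma> x \<noteq> x" using Suc.prems(2)[OF x] by auto
    have "card {x, \<sigma> x} \<le> card A" using Suc.prems(1) x sx by (intro card_mono) auto
    then have c: "int (card (A - {x, \<sigma> x})) = int (card A) - 2"
      using x sx by (subst card_Diff_subset) auto
    have IH: "int (card (avoiding_lists \<sigma> (A - {x, \<sigma> x}) n))
        = (\<Prod>k<n. int (card (A - {x, \<sigma> x})) - 2 * int k)"
    proof (rule Suc.IH)
      fix y assume "y \<in> A - {x, \<sigma> x}"
      then show "\<sigma> y \<in> A - {x, \<sigma> x} \<and> \<sigma> (\<sigma> y) = y \<and> \<sigma> y \<noteq> y"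
        using Suc.prems(2)[of y] sx by auto
    qed (use Suc.prems in auto)
    show ?thesis unfolding IH c by (intro prod.cong) auto
  qed
  have "int (card (avoiding_lists \<sigma> A (Suc n)))
      = (\<Sum>x\<in>A. \<Prod>k<n. int (card A) - 2 * int (Suc k))"
    unfolding card_avoiding_lists_Suc[OF Suc.prems(1)] of_nat_sum by (intro sum.cong) (simp_all only: step)
  also have "\<dots> = int (card A) * (\<Prod>k<n. int (card A) - 2 * int (Suc k))" by simp
  also have "\<dots> = (\<Prod>k<Suc n. int (card A) - 2 * int k)"
    unfolding prod.lessThan_Suc_shift by simp
  finally show ?case .
qed

text \<open>If the first entry is the fixed point \<open>h\<close>, then the rest is counted by the preceding lemma;
  otherwise a pair disappears and \<open>h\<close> stays available. The common factors combine because
  \<open>(card A - 2 + 1 - n) + 1 = card A + 1 - (n + 1)\<close>.\<close>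

lemma card_avoiding_lists_one_fixed:
  assumes "finite A" "h \<notin> A" "\<sigma> h = h"
    "\<And>x. x \<in> A \<Longrightarrow> \<sigma> x \<in> A \<and> \<sigma> (\<sigma> x) = x \<and> \<sigma> x \<noteq> x"
  shows "int (card (avoiding_lists \<sigma> (insert h A) (Suc n)))
    = (\<Prod>k<n. int (card A) - 2 * int k) * (int (card A) + 1 - int n)"
  using assms
proof (induction n arbitrary: A)
  case 0
  then show ?case by (simp add: card_avoiding_lists_Suc avoiding_lists_0)
next
  case (Suc n)
  have step: "int (card (avoiding_lists \<sigma> (insert h A - {x, \<sigma> x}) (Suc n)))
      = (\<Prod>k<n. int (card A) - 2 * int (Suc k)) * (int (card A) - 1 - int n)" if x: "x \<in> A" for x
  proof -
    have sx: "\<sigma> x \<in> A" "\<sigma> (\<sigma> x) = x" "\<sigma> x \<noteq> x" using Suc.prems(4)[OF x] by auto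
    have ins: "insert h A - {x, \<sigma> x} = insert h (A - {x, \<sigma> x})" using sx x Suc.prems(2) by auto
    have "card {x, \<sigma> x} \<le> card A" using Suc.prems(1) x sx by (intro card_mono) auto
    then have c: "int (card (A - {x, \<sigma> x})) = int (card A) - 2"
      using x sx by (subst card_Diff_subset) auto
    have IH: "int (card (avoiding_lists \<sigma> (insert h (A - {x, \<sigma> x})) (Suc n)))
        = (\<Prod>k<n. int (card (A - {x, \<sigma> x})) - 2 * int k) * (int (card (A - {x, \<sigma> x})) + 1 - int n)"
    proof (rule Suc.IH)
      fix y assume "y \<in> A - {x, \<sigma> x}"
      then show "\<sigma> y \<in> A - {x, \<sigma> x} \<and> \<sigma> (\<sigma> y) = y \<and> \<sigma> y \<noteq> y"
        using Suc.prems(4)[of y] sx by auto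
    qed (use Suc.prems in auto)
    show ?thesis unfolding ins IH c by (intro arg_cong2[where f = "(*)"] prod.cong) auto
  qed
  have first: "int (card (avoiding_lists \<sigma> (insert h A - {h, \<sigma> h}) (Suc n)))
      = (\<Prod>k<Suc n. int (card A) - 2 * int k)"
  proof -
    have "insert h A - {h, \<sigma> h} = A" using Suc.prems by auto
    then show ?thesis
      using card_avoiding_lists_free[OF Suc.prems(1,4), of "Suc n"] by (simp only:)
  qed
  have "int (card (avoiding_lists \<sigma> (insert h A) (Suc (Suc n))))
      = (\<Sum>x\<in>insert h A. int (card (avoiding_lists \<sigma> (insert h A - {x, \<sigma> x}) (Suc n))))"
    using Suc.prems(1) by (subst card_avoiding_lists_Suc) simp_all
  also have "\<dots> = (\<Prod>k<Suc n. int (card A) - 2 * int k)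
      + (\<Sum>x\<in>A. int (card (avoiding_lists \<sigma> (insert h A - {x, \<sigma> x}) (Suc n))))"
    unfolding sum.insert[OF Suc.prems(1,2)] first ..
  also have "(\<Sum>x\<in>A. int (card (avoiding_lists \<sigma> (insert h A - {x, \<sigma> x}) (Suc n))))
      = (\<Sum>x\<in>A. (\<Prod>k<n. int (card A) - 2 * int (Suc k)) * (int (card A) - 1 - int n))"
    by (intro sum.cong) (simp_all only: step)
  also have "\<dots> = (int (card A) * (\<Prod>k<n. int (card A) - 2 * int (Suc k))) * (int (card A) - 1 - int n)"
    by simp
  also have "int (card A) * (\<Prod>k<n. int (card A) - 2 * int (Suc k)) = (\<Prod>k<Suc n. int (card A) - 2 * int k)"
    unfolding prod.lessThan_Suc_shift by simp
  finally show ?case by (simp only: algebra_simps of_nat_Suc)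
qed

text \<open>Negation of residues modulo \<open>q\<close>, restricted to the representatives \<open>1, \<dots>, q - 1\<close>, is the
  involution \<open>x \<mapsto> q - x\<close>.\<close>

abbreviation regular_lists :: "nat \<Rightarrow> nat \<Rightarrow> nat list set" where
  "regular_lists q n \<equiv> avoiding_lists (\<lambda>x. q - x) {1..<q} n"

lemma prod_reindex_1: "(\<Prod>k<n. f (Suc k)) = (\<Prod>k=1..n. f k)"
  by (simp add: prod.atLeast1_atMost_eq)

lemma card_regular_lists_odd:
  assumes "odd q"
  shows "int (card (regular_lists q n)) = (\<Prod>k=1..n. int q - (2 * int k - 1))"
proof -
  have "int (card (regular_lists q n)) = (\<Prod>k<n. int (card {1..<q}) - 2 * int k)"
    using assms by (intro card_avoiding_lists_free) (auto, presburger)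
  also have "int (card {1..<q}) = int q - 1" using assms by (cases q) auto
  also have "(\<Prod>k<n. int q - 1 - 2 * int k) = (\<Prod>k<n. int q - (2 * int (Suc k) - 1))"
    by (intro prod.cong) auto
  finally show ?thesis
    unfolding prod_reindex_1[of "\<lambda>k. int q - (2 * int k - 1)"] .
qed

lemma nonzero_residues_even:
  assumes "even q" "q > 0"
  defines "A \<equiv> {1..<q} - {q div 2}"
  shows "{1..<q} = insert (q div 2) A" "finite A" "q div 2 \<notin> A" "q - q div 2 = q div 2"
    "int (card A) = int q - 2"
    "\<And>x. x \<in> A \<Longrightarrow> q - x \<in> A \<and> q - (q - x) = x \<and> q - x \<noteq> x"
proof -
  obtain p where q: "q = 2 * p" using assms(1) by blast
  then have p: "q div 2 = p" "0 < p" "p < q" using assms(2) by auto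
  then show ins: "{1..<q} = insert (q div 2) A" by (auto simp: A_def)
  show fin: "finite A" and notin: "q div 2 \<notin> A" and "q - q div 2 = q div 2"
    by (auto simp: A_def q)
  have "card {1..<q} = Suc (card A)" using ins fin notin by (metis card_insert_disjoint)
  then show "int (card A) = int q - 2" using p by simp
  show "q - x \<in> A \<and> q - (q - x) = x \<and> q - x \<noteq> x" if "x \<in> A" for x
    using that by (auto simp: A_def q)
qed

lemma card_regular_lists_even:
  assumes "even q" "q > 0" "n > 0"
  shows "int (card (regular_lists q n)) = (\<Prod>k=1..n-1. int q - 2 * int k) * (int q - int n)"
proof -
  define A where "A = {1..<q} - {q div 2}"
  note A = nonzero_residues_even[OF assms(1,2), folded A_def]
  obtain m where n: "n = Suc m" using assms(3) by (cases n) auto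
  have "int (card (regular_lists q n))
      = (\<Prod>k<m. int q - 2 - 2 * int k) * (int q - 2 + 1 - int m)"
    unfolding n A(1) A(5)[symmetric]
    by (rule card_avoiding_lists_one_fixed[OF A(2,3,4,6)])
  also have "(\<Prod>k<m. int q - 2 - 2 * int k) = (\<Prod>k<m. int q - 2 * int (Suc k))"
    by (intro prod.cong) auto
  also have "int q - 2 + 1 - int m = int q - int n" by (simp add: n)
  finally show ?thesis
    unfolding prod_reindex_1[of "\<lambda>k. int q - 2 * int k"] by (simp add: n)
qed

text \<open>These lists start with the fixed point \<open>q / 2\<close>, after which the involution is free on the
  values left.\<close>

lemma card_regular_lists_half:
  assumes "even q" "q > 0"
  shows "int (card {xs \<in> regular_lists q (Suc n). 2 * hd xs = q}) = (\<Prod>k=1..n. int q - 2 * int k)"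
proof -
  define A where "A = {1..<q} - {q div 2}"
  note A = nonzero_residues_even[OF assms, folded A_def]
  have rest: "{1..<q} - {q div 2, q - q div 2} = A" using A(4) by (simp add: A_def)
  have "{xs \<in> regular_lists q (Suc n). 2 * hd xs = q} = (#) (q div 2) ` avoiding_lists (\<lambda>x. q - x) A n"
  proof (rule Set.set_eqI)
    fix ys
    show "ys \<in> {xs \<in> regular_lists q (Suc n). 2 * hd xs = q}
      \<longleftrightarrow> ys \<in> (#) (q div 2) ` avoiding_lists (\<lambda>x. q - x) A n"
    proof (cases ys)
      case Nil
      then show ?thesis by (auto simp: avoiding_lists_def)
    next
      case (Cons x xs)
      have "2 * x = q \<longleftrightarrow> x = q div 2" using assms by auto
      moreover have "q div 2 \<in> {1..<q}" using A(1) by blast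
      ultimately show ?thesis using Cons rest by (auto simp: Cons_avoiding_lists)
    qed
  qed
  then have "int (card {xs \<in> regular_lists q (Suc n). 2 * hd xs = q})
      = int (card (avoiding_lists (\<lambda>x. q - x) A n))"
    by (simp add: card_image)
  also have "\<dots> = (\<Prod>k<n. int q - 2 - 2 * int k)"
    unfolding A(5)[symmetric] by (rule card_avoiding_lists_free[OF A(2,6)])
  also have "\<dots> = (\<Prod>k<n. int q - 2 * int (Suc k))" by (intro prod.cong) auto
  finally show ?thesis
    unfolding prod_reindex_1[of "\<lambda>k. int q - 2 * int k"] .
qed

lemma multiple_iff_dvd:
  "r = of_int d \<Longrightarrow> (\<exists>k::int. r = real q * of_int k) \<longleftrightarrow> int q dvd d"
proof -
  assume "r = of_int d"
  then have "r = real q * of_int k \<longleftrightarrow> d = int q * k" for k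
    by (metis of_int_eq_iff of_int_mult of_int_of_nat_eq)
  then show ?thesis by (auto simp: dvd_def)
qed

section \<open>Groups generated by reflections\<close>

lemma reflection_linear: "linear (reflection a)"
  by (intro linearI) (auto simp: reflection_def algebra_simps inner_add_right add_divide_distrib scaleR_add_left)

lemma reflection_inner: "reflection a x \<bullet> reflection a y = x \<bullet> y"
proof (cases "a = 0")
  case True
  then show ?thesis by (simp add: reflection_def)
next
  case False
  define c d where "c = 2 * (a \<bullet> x) / (a \<bullet> a)" and "d = 2 * (a \<bullet> y) / (a \<bullet> a)"
  have "c * (a \<bullet> a) = 2 * (a \<bullet> x)" using False by (simp add: c_def)
  then have "c * (d * (a \<bullet> a)) = 2 * (d * (a \<bullet> x))" by (metis mult.left_commute)
  moreover have "d * (a \<bullet> x) = c * (a \<bullet> y)" by (simp add: c_def d_def)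
  moreover have "(x - c *\<^sub>R a) \<bullet> (y - d *\<^sub>R a)
      = x \<bullet> y - d * (a \<bullet> x) - c * (a \<bullet> y) + c * (d * (a \<bullet> a))"
    by (simp add: inner_diff_left inner_diff_right inner_commute[of x a] right_diff_distrib)
  ultimately show ?thesis
    unfolding reflection_def c_def[symmetric] d_def[symmetric] by linarith
qed

lemma reflection_reflection: "reflection a (reflection a x) = x"
proof (cases "a = 0")
  case True
  then show ?thesis by (simp add: reflection_def)
next
  case False
  define c where "c = 2 * (a \<bullet> x) / (a \<bullet> a)"
  have "c * (a \<bullet> a) = 2 * (a \<bullet> x)" using False by (simp add: c_def)
  then have "2 * (a \<bullet> (x - c *\<^sub>R a)) / (a \<bullet> a) = - c"
    using False by (simp add: inner_diff_right c_def)
  then show ?thesis unfolding reflection_def c_def[symmetric] by simp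
qed

lemma reflection_adjoint: "reflection a x \<bullet> y = x \<bullet> reflection a y"
  by (metis reflection_inner reflection_reflection)

lemma reflection_Bij: "reflection a \<in> Bij UNIV"
  unfolding Bij_def by (auto intro!: o_bij[of "reflection a"] simp: fun_eq_iff reflection_reflection)

lemma BijGroup_UNIV_one: "\<one>\<^bsub>BijGroup UNIV\<^esub> = id"
  by (simp add: BijGroup_def id_def restrict_def)

lemma BijGroup_UNIV_mult:
  assumes "v \<in> carrier (BijGroup UNIV)" "w \<in> carrier (BijGroup UNIV)"
  shows "v \<otimes>\<^bsub>BijGroup UNIV\<^esub> w = v \<circ> w"
  using assms by (simp add: BijGroup_def compose_def o_def restrict_def)

lemma reflections_carrier: "R \<subseteq> range reflection \<Longrightarrow> R \<subseteq> carrier (BijGroup UNIV)"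
  using reflection_Bij by (auto simp: BijGroup_def)

text \<open>A reflection is its own inverse, so the inverses of generators are generators and it suffices to
  follow compositions.\<close>

lemma generate_reflections_subset:
  assumes "R \<subseteq> range reflection" "R \<subseteq> H" "id \<in> H" "\<And>v w. v \<in> H \<Longrightarrow> w \<in> H \<Longrightarrow> v \<circ> w \<in> H"
  shows "generate (BijGroup UNIV) R \<subseteq> (H :: ('a::real_inner \<Rightarrow> 'a) set)"
proof
  note carrier = group.generate_in_carrier[OF group_BijGroup reflections_carrier[OF assms(1)]]
  fix w assume "w \<in> generate (BijGroup UNIV) R"
  then show "w \<in> H"
  proof induction
    case one
    then show ?case using assms(3) by (simp only: BijGroup_UNIV_one)
  next
    case (incl h)
    then show ?case using assms(2) by blast
  next
    case (inv h)
    then obtain a where a: "h = reflection a" using assms(1) by blast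
    have "inv_into UNIV h = h"
      unfolding a by (rule inv_equality) (simp_all add: reflection_reflection)
    then have "m_inv (BijGroup UNIV) h = h"
      using reflection_Bij[of a] a by (simp add: inv_BijGroup restrict_def)
    then show ?case using inv assms(2) by auto
  next
    case (eng v w)
    have "v \<otimes>\<^bsub>BijGroup UNIV\<^esub> w = v \<circ> w"
      by (rule BijGroup_UNIV_mult[OF carrier[OF eng(1)] carrier[OF eng(2)]])
    then show ?case using eng assms(4) by (simp only:)
  qed
qed

lemma word_in_generate:
  assumes "set ss \<subseteq> R" "R \<subseteq> range reflection"
  shows "foldr (\<circ>) ss id \<in> generate (BijGroup UNIV) (R :: ('a::real_inner \<Rightarrow> 'a) set)"
  using assms(1)
proof (induction ss)
  case Nil
  then show ?case
    using generate.one[of "BijGroup UNIV" R] by (simp add: BijGroup_UNIV_one id_def)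
next
  case (Cons s ss)
  note carrier = group.generate_in_carrier[OF group_BijGroup reflections_carrier[OF assms(2)]]
  have s: "s \<in> generate (BijGroup UNIV) R"
    using Cons.prems by (auto intro: generate.incl)
  have w: "foldr (\<circ>) ss id \<in> generate (BijGroup UNIV) R"
    by (rule Cons.IH) (use Cons.prems in auto)
  have "foldr (\<circ>) (s # ss) id = s \<circ> foldr (\<circ>) ss id" by simp
  also have "\<dots> = s \<otimes>\<^bsub>BijGroup UNIV\<^esub> foldr (\<circ>) ss id"
    by (rule BijGroup_UNIV_mult[OF carrier[OF s] carrier[OF w], symmetric])
  finally show ?case using generate.eng[OF s w] by (simp only:)
qed

section \<open>The root system in coordinates\<close>

locale type_B =
  fixes e :: "nat \<Rightarrow> 'a::euclidean_space" and l :: nat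
  assumes basis: "bij_betw e {1..l} (Basis :: 'a set)"
    and rank: "l \<ge> 2"
begin

lemma inner_e:
  assumes "i \<in> {1..l}" "k \<in> {1..l}"
  shows "e i \<bullet> e k = (if i = k then 1 else 0)"
proof -
  have "e i \<in> Basis" "e k \<in> Basis" "e i = e k \<longleftrightarrow> i = k"
    using basis assms by (auto simp: bij_betw_def inj_on_eq_iff)
  then show ?thesis by (simp add: inner_Basis)
qed

lemma sum_coords: "(\<Sum>k=1..l. (e k \<bullet> x) *\<^sub>R e k) = x"
  using sum.reindex_bij_betw[OF basis, of "\<lambda>b. (b \<bullet> x) *\<^sub>R b"]
  by (simp add: euclidean_representation inner_commute[of _ x])

lemma coord_sum:
  assumes "k \<in> {1..l}" "I \<subseteq> {1..l}"
  shows "e k \<bullet> (\<Sum>j\<in>I. c j *\<^sub>R e j) = (if k \<in> I then c k else 0)"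
proof -
  have "finite I" using assms(2) finite_subset by blast
  have "e k \<bullet> (\<Sum>j\<in>I. c j *\<^sub>R e j) = (\<Sum>j\<in>I. if k = j then c j else 0)"
    unfolding inner_sum_right using assms by (intro sum.cong) (auto simp: inner_e)
  then show ?thesis using \<open>finite I\<close> by simp
qed

lemma coord_eqI:
  assumes "\<And>k. k \<in> {1..l} \<Longrightarrow> e k \<bullet> x = e k \<bullet> y"
  shows "x = y"
proof -
  have "(\<Sum>k=1..l. (e k \<bullet> x) *\<^sub>R e k) = (\<Sum>k=1..l. (e k \<bullet> y) *\<^sub>R e k)"
    using assms by (intro sum.cong) auto
  then show ?thesis by (simp only: sum_coords)
qed

lemma inner_coords: "x \<bullet> y = (\<Sum>k=1..l. (e k \<bullet> x) * (e k \<bullet> y))"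
proof -
  have "x \<bullet> y = (\<Sum>k=1..l. (e k \<bullet> x) *\<^sub>R e k) \<bullet> y" by (simp only: sum_coords)
  then show ?thesis by (simp add: inner_sum_left)
qed

abbreviation "\<Phi> \<equiv> B_roots e l"
abbreviation "\<alpha> \<equiv> B_simple e l"

text \<open>The short roots carry the whole structure: the other roots are the sums of two orthogonal short
  roots, so every orthogonal map that permutes the short roots permutes all roots.\<close>

definition short_roots :: "'a set" where
  "short_roots = {s *\<^sub>R e k | s k. s \<in> {1, -1} \<and> k \<in> {1..l}}"

lemma short_rootE:
  assumes "a \<in> short_roots"
  obtains s k where "a = s *\<^sub>R e k" "s = 1 \<or> s = -1" "k \<in> {1..l}"
  using assms unfolding short_roots_def by blast

lemma short_rootI: "s = 1 \<or> s = -1 \<Longrightarrow> k \<in> {1..l} \<Longrightarrow> s *\<^sub>R e k \<in> short_roots"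
  unfolding short_roots_def by auto

lemma e_short_root: "k \<in> {1..l} \<Longrightarrow> e k \<in> short_roots"
  using short_rootI[of 1 k] by simp

lemma rootE:
  assumes "a \<in> \<Phi>"
  obtains s t i k where "a = s *\<^sub>R e i + t *\<^sub>R e k" "s = 1 \<or> s = -1" "t = 1 \<or> t = -1"
      "i \<in> {1..l}" "k \<in> {1..l}" "i < k"
    | s k where "a = s *\<^sub>R e k" "s = 1 \<or> s = -1" "k \<in> {1..l}"
proof -
  consider (long) "a \<in> {s *\<^sub>R e i + t *\<^sub>R e k | s t i k. s \<in> {1, -1} \<and> t \<in> {1, -1} \<and> 1 \<le> i \<and> i < k \<and> k \<le> l}"
    | (short) "a \<in> {s *\<^sub>R e k | s k. s \<in> {1, -1} \<and> 1 \<le> k \<and> k \<le> l}"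
    using assms unfolding B_roots_def by blast
  then show thesis
  proof cases
    case long
    then obtain s t i k where "a = s *\<^sub>R e i + t *\<^sub>R e k" "s \<in> {1, -1}" "t \<in> {1, -1}" "1 \<le> i" "i < k" "k \<le> l"
      by blast
    then show thesis using that(1)[of s i t k] by auto
  next
    case short
    then obtain s k where "a = s *\<^sub>R e k" "s \<in> {1, -1}" "1 \<le> k" "k \<le> l"
      by blast
    then show thesis using that(2)[of s k] by auto
  qed
qed

lemma long_rootI:
  "s = 1 \<or> s = -1 \<Longrightarrow> t = 1 \<or> t = -1 \<Longrightarrow> i \<in> {1..l} \<Longrightarrow> k \<in> {1..l} \<Longrightarrow> i < k \<Longrightarrow>
    s *\<^sub>R e i + t *\<^sub>R e k \<in> \<Phi>"
  unfolding B_roots_def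
  by (intro UnI1 CollectI exI[of _ s] exI[of _ t] exI[of _ i] exI[of _ k]) auto

lemma roots_eq: "\<Phi> = short_roots \<union> {a + b | a b. a \<in> short_roots \<and> b \<in> short_roots \<and> a \<bullet> b = 0}"
proof (intro equalityI subsetI)
  fix a assume "a \<in> \<Phi>"
  then show "a \<in> short_roots \<union> {a + b | a b. a \<in> short_roots \<and> b \<in> short_roots \<and> a \<bullet> b = 0}"
  proof (cases rule: rootE)
    case (1 s t i k)
    moreover have "(s *\<^sub>R e i) \<bullet> (t *\<^sub>R e k) = 0" using 1 by (simp add: inner_e)
    ultimately show ?thesis using short_rootI by blast
  next
    case (2 s k)
    then show ?thesis using short_rootI by blast
  qed
next
  fix a assume "a \<in> short_roots \<union> {a + b | a b. a \<in> short_roots \<and> b \<in> short_roots \<and> a \<bullet> b = 0}"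
  then consider "a \<in> short_roots" | b c where "a = b + c" "b \<in> short_roots" "c \<in> short_roots" "b \<bullet> c = 0"
    by blast
  then show "a \<in> \<Phi>"
  proof cases
    case 1
    then show ?thesis unfolding B_roots_def short_roots_def by auto
  next
    case (2 b c)
    obtain s i where b: "b = s *\<^sub>R e i" "s = 1 \<or> s = -1" "i \<in> {1..l}" using short_rootE 2 by blast
    obtain t k where c: "c = t *\<^sub>R e k" "t = 1 \<or> t = -1" "k \<in> {1..l}" using short_rootE 2 by blast
    have "i \<noteq> k" using 2 b c by (auto simp: inner_e)
    then show ?thesis
      using long_rootI[of s t i k] long_rootI[of t s k i] b c 2 by (cases i k rule: linorder_cases) (auto simp: add.commute)
  qed
qed

lemma finite_roots: "finite \<Phi>"
proof -
  have "short_roots \<subseteq> (\<lambda>(s, k). s *\<^sub>R e k) ` ({1, -1} \<times> {1..l})"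
    unfolding short_roots_def by auto
  then have fin: "finite short_roots" by (rule finite_subset) auto
  have "\<Phi> \<subseteq> short_roots \<union> (\<lambda>(a, b). a + b) ` (short_roots \<times> short_roots)"
    unfolding roots_eq by auto
  then show ?thesis by (rule finite_subset) (use fin in auto)
qed

lemma simple_root:
  assumes "i \<in> {1..l}"
  shows "\<alpha> i \<in> \<Phi>"
proof (cases "i < l")
  case True
  then show ?thesis using long_rootI[of 1 "-1" i "i + 1"] assms by (simp add: B_simple_def)
next
  case False
  then show ?thesis using e_short_root[of l] rank unfolding roots_eq by (simp add: B_simple_def)
qed

section \<open>Signed permutations\<close>

text \<open>The orthogonal maps that permute the vectors \<open>\<plusminus> e k\<close> are exactly the signed permutations of the
  coordinates. They turn out to form the Weyl group, see \<open>weyl_group_eq\<close> below.\<close>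

definition signed_perms :: "('a \<Rightarrow> 'a) set" where
  "signed_perms = {w. orthogonal_transformation w \<and> w ` short_roots = short_roots}"

lemma signed_perm_linear: "w \<in> signed_perms \<Longrightarrow> linear w"
  and signed_perm_inner: "w \<in> signed_perms \<Longrightarrow> w x \<bullet> w y = x \<bullet> y"
  by (auto simp: signed_perms_def orthogonal_transformation_def)

lemma signed_perm_id: "id \<in> signed_perms"
  by (simp add: signed_perms_def orthogonal_transformation_def linear_id)

lemma signed_perm_comp: "v \<in> signed_perms \<Longrightarrow> w \<in> signed_perms \<Longrightarrow> v \<circ> w \<in> signed_perms"
  by (metis (mono_tags, lifting) image_comp mem_Collect_eq orthogonal_transformation_compose signed_perms_def)

lemma signed_perm_bij: "w \<in> signed_perms \<Longrightarrow> bij w"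
  by (simp add: signed_perms_def orthogonal_transformation_bij)

lemma signed_perm_roots:
  assumes "w \<in> signed_perms"
  shows "w ` \<Phi> = \<Phi>"
proof (rule endo_inj_surj[OF finite_roots])
  have sr: "w b \<in> short_roots" if "b \<in> short_roots" for b
    using assms that by (auto simp: signed_perms_def)
  show "w ` \<Phi> \<subseteq> \<Phi>"
  proof
    fix a assume "a \<in> w ` \<Phi>"
    then consider b where "a = w b" "b \<in> short_roots"
      | b c where "a = w (b + c)" "b \<in> short_roots" "c \<in> short_roots" "b \<bullet> c = 0"
      unfolding roots_eq by blast
    then show "a \<in> \<Phi>"
    proof cases
      case 1
      then show ?thesis using sr unfolding roots_eq by blast
    next
      case (2 b c)
      then have "a = w b + w c" "w b \<bullet> w c = 0"
        using linear_add[OF signed_perm_linear[OF assms]] signed_perm_inner[OF assms] by auto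
      then show ?thesis using sr 2 unfolding roots_eq by blast
    qed
  qed
  show "inj_on w \<Phi>"
    using signed_perm_bij[OF assms] bij_is_inj inj_on_subset by blast
qed

lemma reflection_signed_perm:
  assumes "a \<in> \<Phi>"
  shows "reflection a \<in> signed_perms"
proof -
  have "reflection a b \<in> short_roots" if short: "b \<in> short_roots" for b
  proof -
    obtain r j where b: "b = r *\<^sub>R e j" "r = 1 \<or> r = -1" "j \<in> {1..l}" using short_rootE[OF short] .
    from assms show ?thesis
    proof (cases rule: rootE)
      case (1 s t i k)
      have ss: "s * s = 1" "t * t = 1" using 1 by auto
      have aa: "a \<bullet> a = 2"
        using 1 ss by (simp add: inner_e inner_add_left inner_add_right)
      consider "j = i" | "j = k" | "j \<noteq> i" "j \<noteq> k" by blast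
      then show ?thesis
      proof cases
        assume "j = i"
        then have "a \<bullet> b = s * r" using 1 b by (simp add: inner_e inner_add_left)
        then have "reflection a b = (- r * s * t) *\<^sub>R e k"
          using 1 b aa ss \<open>j = i\<close> by (auto simp: reflection_def algebra_simps)
        then show ?thesis using 1 b short_rootI[of "- r * s * t" k] by fastforce
      next
        assume "j = k"
        then have "a \<bullet> b = t * r" using 1 b by (simp add: inner_e inner_add_left)
        then have "reflection a b = (- r * s * t) *\<^sub>R e i"
          using 1 b aa ss \<open>j = k\<close> by (auto simp: reflection_def algebra_simps)
        then show ?thesis using 1 b short_rootI[of "- r * s * t" i] by fastforce
      next
        assume "j \<noteq> i" "j \<noteq> k"
        then have "a \<bullet> b = 0" using 1 b by (simp add: inner_e inner_add_left)
        then show ?thesis using short by (simp add: reflection_def)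
      qed
    next
      case (2 s k)
      show ?thesis
      proof (cases "j = k")
        case True
        then have "reflection a b = (- r) *\<^sub>R e k"
          using 2 b by (auto simp: reflection_def inner_e algebra_simps scaleR_2)
        then show ?thesis using 2 b short_rootI[of "- r" k] by fastforce
      next
        case False
        then have "a \<bullet> b = 0" using 2 b by (simp add: inner_e)
        then show ?thesis using short by (simp add: reflection_def)
      qed
    qed
  qed
  then have "reflection a ` short_roots = short_roots"
    by (metis image_eqI image_subsetI reflection_reflection subsetI subset_antisym)
  then show ?thesis
    by (simp add: signed_perms_def orthogonal_transformation_def reflection_linear reflection_inner)
qed

text \<open>This is half the sum of the positive coroots. It takes the value 1 on each simple root, and its
  value on any root is the height.\<close>

definition \<rho> :: 'a where
  "\<rho> = (\<Sum>k=1..l. real (l + 1 - k) *\<^sub>R e k)"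

lemma coord_rho: "k \<in> {1..l} \<Longrightarrow> e k \<bullet> \<rho> = real (l + 1 - k)"
  unfolding \<rho>_def by (subst coord_sum) auto

lemma simple_rho: "i \<in> {1..l} \<Longrightarrow> \<alpha> i \<bullet> \<rho> = 1"
  by (cases "i < l") (auto simp: B_simple_def inner_diff_left coord_rho of_nat_diff)

lemma root_rho_nonzero:
  assumes "a \<in> \<Phi>"
  shows "a \<bullet> \<rho> \<noteq> 0"
  using assms
proof (cases rule: rootE)
  case (1 s t i k)
  have "a \<bullet> \<rho> = s * real (l + 1 - i) + t * real (l + 1 - k)"
    using 1 by (simp add: inner_add_left coord_rho)
  moreover have "0 < real (l + 1 - k)" "real (l + 1 - k) < real (l + 1 - i)" using 1 by auto
  ultimately show ?thesis using 1(2,3) by (elim disjE; simp only:; linarith)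
next
  case (2 s k)
  then have "a \<bullet> \<rho> = s * real (l + 1 - k)" by (simp add: coord_rho)
  moreover have "0 < real (l + 1 - k)" using 2 by simp
  ultimately show ?thesis using 2(2) by (elim disjE; simp only:; linarith)
qed

lemma signed_perm_regular:
  assumes "w \<in> signed_perms" "a \<in> \<Phi>"
  shows "a \<bullet> w \<rho> \<noteq> 0"
proof -
  obtain b where "b \<in> \<Phi>" "a = w b" using signed_perm_roots[OF assms(1)] assms(2) by blast
  then show ?thesis using signed_perm_inner[OF assms(1)] root_rho_nonzero by simp
qed

text \<open>The coordinates of \<open>w \<rho>\<close> are the numbers \<open>1, \<dots>, l\<close> up to order and sign.\<close>

lemma signed_perm_coord:
  assumes "w \<in> signed_perms" "k \<in> {1..l}"
  obtains s j where "s = 1 \<or> s = -1" "j \<in> {1..l}" "w (s *\<^sub>R e j) = e k"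
    "e k \<bullet> w \<rho> = s * real (l + 1 - j)"
proof -
  have "e k \<in> w ` short_roots" using assms e_short_root by (simp add: signed_perms_def)
  then obtain b where b: "b \<in> short_roots" "e k = w b" by blast
  obtain s j where sj: "b = s *\<^sub>R e j" "s = 1 \<or> s = -1" "j \<in> {1..l}" using b short_rootE by blast
  have "e k \<bullet> w \<rho> = s * real (l + 1 - j)"
    using b sj signed_perm_inner[OF assms(1)] by (simp add: coord_rho)
  then show thesis using that b sj by simp
qed

text \<open>This is the parabolic subgroup of type \<open>B\<close> acting on the coordinates from \<open>m\<close> on; the equality
  with the subgroup generated by the corresponding simple reflections is \<open>generate_parabolic\<close>.\<close>

definition parabolic :: "nat \<Rightarrow> ('a \<Rightarrow> 'a) set" where
  "parabolic m = {w \<in> signed_perms. \<forall>j\<in>{1..<m}. w (e j) = e j}"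

lemma parabolic_1: "parabolic 1 = signed_perms"
  by (simp add: parabolic_def)

lemma parabolic_signed_perm: "w \<in> parabolic m \<Longrightarrow> w \<in> signed_perms"
  by (simp add: parabolic_def)

lemma parabolic_coord_fixed:
  assumes "w \<in> parabolic m" "j \<in> {1..<m}"
  shows "e j \<bullet> w x = e j \<bullet> x"
  using assms signed_perm_inner[of w "e j" x] by (simp add: parabolic_def)

text \<open>The values \<open>l, \<dots>, l + 2 - m\<close> are already used by the fixed coordinates.\<close>

lemma parabolic_coord_bound:
  assumes "w \<in> parabolic m" "k \<in> {m..l}" "1 \<le> m"
  shows "\<bar>e k \<bullet> w \<rho>\<bar> \<le> real (l + 1 - m)"
proof -
  have w: "w \<in> signed_perms" using assms parabolic_signed_perm by blast
  obtain s j where sj: "s = 1 \<or> s = -1" "j \<in> {1..l}" "w (s *\<^sub>R e j) = e k"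
    "e k \<bullet> w \<rho> = s * real (l + 1 - j)" using signed_perm_coord[OF w, of k] assms by auto
  have "\<not> j < m"
  proof
    assume "j < m"
    then have "e j \<bullet> e k = e j \<bullet> (s *\<^sub>R e j)"
      using parabolic_coord_fixed[OF assms(1), of j "s *\<^sub>R e j"] sj by simp
    then show False using \<open>j < m\<close> sj assms by (auto simp: inner_e)
  qed
  then show ?thesis using sj by auto
qed

text \<open>The coordinates of \<open>w \<rho>\<close> from \<open>m\<close> on are integers that decrease strictly, end with a positive
  number and start with at most \<open>l + 1 - m\<close>. That leaves no room: they are
  \<open>l + 1 - m, \<dots>, 1\<close>. So \<open>w\<close> fixes \<open>\<rho>\<close>, and a signed permutation is determined by its value
  at \<open>\<rho>\<close>, whose coordinates are positive and distinct.\<close>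

lemma dominant_imp_id:
  assumes w: "w \<in> parabolic m" and m: "1 \<le> m"
    and dom: "\<And>i. i \<in> {m..l} \<Longrightarrow> \<alpha> i \<bullet> w \<rho> > 0"
  shows "w = id"
proof -
  define u where "u k = e k \<bullet> w \<rho>" for k
  have sp: "w \<in> signed_perms" using w parabolic_signed_perm by blast
  have int: "u k \<in> \<int>" if "k \<in> {1..l}" for k
    using signed_perm_coord[OF sp that] unfolding u_def by (metis Ints_1 Ints_minus Ints_mult Ints_of_nat)
  have drop: "u (Suc k) + 1 \<le> u k" if "k \<in> {m..<l}" for k
  proof -
    have "u (Suc k) < u k" using dom[of k] that by (simp add: B_simple_def u_def inner_diff_left)
    moreover have "u (Suc k) \<in> \<int>" "u k \<in> \<int>" using that m int by auto
    ultimately show ?thesis by (auto elim!: Ints_cases)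
  qed
  have last: "u l \<ge> 1" if "m \<le> l"
  proof -
    have "u l > 0" using dom[of l] that by (simp add: B_simple_def u_def)
    moreover have "u l \<in> \<int>" using rank int by auto
    ultimately show ?thesis by (auto elim!: Ints_cases)
  qed
  have lower: "u k \<ge> real (l + 1 - k)" if "m \<le> k" "k \<le> l" for k
    using that(2,1)
  proof (induction k rule: inc_induct)
    case base
    then show ?case using last by simp
  next
    case (step n)
    then show ?case using drop[of n] by (auto simp: of_nat_diff)
  qed
  have upper: "u k \<le> real (l + 1 - k)" if "m \<le> k" "k \<le> l" for k
    using that
  proof (induction k rule: dec_induct)
    case base
    then show ?case using parabolic_coord_bound[OF w _ m, of m] by (auto simp: u_def)
  next
    case (step n)
    then show ?case using drop[of n] by (auto simp: of_nat_diff)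
  qed
  have u: "u k = real (l + 1 - k)" if "k \<in> {1..l}" for k
    using lower[of k] upper[of k] parabolic_coord_fixed[OF w, of k \<rho>] coord_rho[OF that] that
    by (cases "k < m") (auto simp: u_def)
  have fixed: "w (e k) = e k" if k: "k \<in> {1..l}" for k
  proof -
    obtain s j where sj: "s = 1 \<or> s = -1" "j \<in> {1..l}" "w (s *\<^sub>R e j) = e k"
      "e k \<bullet> w \<rho> = s * real (l + 1 - j)" using signed_perm_coord[OF sp k] by blast
    then have "s * real (l + 1 - j) = real (l + 1 - k)" using u[OF k] by (simp add: u_def)
    then have "s = 1 \<and> j = k" using sj k by (auto simp: of_nat_diff)
    then show ?thesis using sj by simp
  qed
  show ?thesis
  proof
    fix x
    show "w x = id x"
    proof (rule coord_eqI)
      fix k assume "k \<in> {1..l}"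
      then show "e k \<bullet> w x = e k \<bullet> id x"
        using signed_perm_inner[OF sp, of "e k" x] fixed by simp
    qed
  qed
qed


section \<open>Inversions and word length\<close>

definition pos_roots :: "'a set" where
  "pos_roots = {a \<in> \<Phi>. a \<bullet> \<rho> > 0}"

lemma simple_pos_root: "i \<in> {1..l} \<Longrightarrow> \<alpha> i \<in> pos_roots"
  by (simp add: pos_roots_def simple_root simple_rho)

text \<open>The reflection changes the height of \<open>a\<close> by a multiple of the inner product with \<open>\<alpha> i\<close>. It
  suffices that the new height is not negative, because no root has height 0.\<close>

lemma simple_reflection_pos_root:
  assumes i: "i \<in> {1..l}" and a: "a \<in> pos_roots" "a \<noteq> \<alpha> i"
  shows "reflection (\<alpha> i) a \<in> pos_roots"
proof -
  have root: "reflection (\<alpha> i) a \<in> \<Phi>"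
    using signed_perm_roots[OF reflection_signed_perm[OF simple_root[OF i]]] a
    by (auto simp: pos_roots_def)
  have "reflection (\<alpha> i) a \<bullet> \<rho> = a \<bullet> \<rho> - 2 * (\<alpha> i \<bullet> a) / (\<alpha> i \<bullet> \<alpha> i)"
    using simple_rho[OF i] by (simp add: reflection_def inner_diff_left)
  also have "\<dots> \<ge> 0"
  proof -
    have aPhi: "a \<in> \<Phi>" and pos: "a \<bullet> \<rho> > 0" using a by (auto simp: pos_roots_def)
    have "a \<bullet> \<rho> \<ge> 2 * (\<alpha> i \<bullet> a) / (\<alpha> i \<bullet> \<alpha> i)"
    proof (cases "i < l")
      case True
      then have ii: "\<alpha> i \<bullet> \<alpha> i = 2" using i
        by (simp add: B_simple_def inner_diff_left inner_diff_right inner_e)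
      from aPhi have "a \<bullet> \<rho> \<ge> \<alpha> i \<bullet> a"
      proof (cases rule: rootE)
        case (1 s t j k)
        have ht: "a \<bullet> \<rho> = s * real (l + 1 - j) + t * real (l + 1 - k)"
          using 1 by (simp add: inner_add_left coord_rho)
        have lt: "real (l + 1 - k) + 1 \<le> real (l + 1 - j)" "1 \<le> real (l + 1 - k)" using 1 by auto
        have s: "s = 1" using ht lt pos 1(2,3) by auto
        \<comment> \<open>The inner product would be 2 only for \<open>a = \<alpha> i\<close>; otherwise it is at most 1, and the height
          is at least 1.\<close>
        have ht1: "a \<bullet> \<rho> \<ge> 1" using ht lt s 1(3) by auto
        have ca: "\<alpha> i \<bullet> a = (if i = j then 1 else 0) - (if i + 1 = j then 1 else 0)
            + t * ((if i = k then 1 else 0) - (if i + 1 = k then 1 else 0))"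
          using 1 True i s
          by (simp add: B_simple_def inner_diff_left inner_add_right inner_e algebra_simps)
        have "\<not> (i = j \<and> i + 1 = k \<and> t = -1)" using a True 1 s by (auto simp: B_simple_def)
        then have "\<alpha> i \<bullet> a \<le> 1" using ca 1(3,6) by (auto split: if_splits)
        then show ?thesis using ht1 by linarith
      next
        case (2 s k)
        then have "s = 1" using pos by (auto simp: coord_rho)
        moreover have "1 \<le> real (l + 1 - k)" using 2 by auto
        ultimately show ?thesis using 2 True i
          by (simp add: B_simple_def inner_diff_left inner_e coord_rho)
      qed
      then show ?thesis using ii by simp
    next
      case False
      then have il: "i = l" using i by simp
      then have ii: "\<alpha> i = e l" "\<alpha> i \<bullet> \<alpha> i = 1" using rank by (auto simp: B_simple_def inner_e)
      from aPhi have "a \<bullet> \<rho> \<ge> 2 * (\<alpha> i \<bullet> a)"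
      proof (cases rule: rootE)
        case (1 s t j k)
        have ht: "a \<bullet> \<rho> = s * real (l + 1 - j) + t * real (l + 1 - k)"
          using 1 by (simp add: inner_add_left coord_rho)
        have lt: "real (l + 1 - k) + 1 \<le> real (l + 1 - j)" "1 \<le> real (l + 1 - k)" using 1 by auto
        have s: "s = 1" using ht lt pos 1(2,3) by auto
        have "\<alpha> i \<bullet> a = (if k = l then t else 0)"
          using 1 ii s by (auto simp: inner_add_right inner_e)
        moreover have "k = l \<Longrightarrow> real (l + 1 - k) = 1" by simp
        ultimately show ?thesis using ht lt s 1(3) by (cases "k = l") auto
      next
        case (2 s k)
        then have "s = 1" using pos by (auto simp: coord_rho)
        then have "k \<noteq> l" using a ii 2 by auto
        then show ?thesis using 2 ii pos by (simp add: inner_e)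
      qed
      then show ?thesis using ii by simp
    qed
    then show ?thesis by simp
  qed
  finally show ?thesis
    using root root_rho_nonzero[OF root] by (simp add: pos_roots_def)
qed

text \<open>These positive roots \<open>a\<close> are the ones that the inverse of \<open>w\<close> makes negative, because
  \<open>a \<bullet> w \<rho>\<close> is the height of the preimage of \<open>a\<close>.\<close>

definition inversions :: "('a \<Rightarrow> 'a) \<Rightarrow> 'a set" where
  "inversions w = {a \<in> pos_roots. a \<bullet> w \<rho> < 0}"

lemma finite_inversions: "finite (inversions w)"
  using finite_roots by (simp add: inversions_def pos_roots_def)

lemma inversions_reflect:
  assumes "i \<in> {1..l}" "a \<in> inversions (reflection (\<alpha> i) \<circ> w)" "a \<noteq> \<alpha> i"
  shows "reflection (\<alpha> i) a \<in> inversions w"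
  using assms simple_reflection_pos_root[of i a]
  by (simp add: inversions_def reflection_adjoint)

text \<open>A simple reflection maps the inversions of \<open>s \<circ> w\<close> other than its own simple root to inversions
  of \<open>w\<close>, so each letter of a word adds at most one inversion.\<close>

lemma word_inversions:
  assumes "set ss \<subseteq> simple_reflections \<alpha> {1..l}"
  shows "card (inversions (foldr (\<circ>) ss id)) \<le> length ss"
  using assms
proof (induction ss)
  case Nil
  have "inversions (\<lambda>x. x) = {}" by (auto simp: inversions_def pos_roots_def)
  then show ?case by (simp add: id_def)
next
  case (Cons s ss)
  let ?w = "foldr (\<circ>) ss id"
  obtain i where i: "i \<in> {1..l}" "s = reflection (\<alpha> i)"
    using Cons.prems by (auto simp: simple_reflections_def)
  have "inversions (s \<circ> ?w) \<subseteq> insert (\<alpha> i) (s ` inversions ?w)"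
  proof
    fix a assume "a \<in> inversions (s \<circ> ?w)"
    then show "a \<in> insert (\<alpha> i) (s ` inversions ?w)"
      using inversions_reflect[of i a ?w] i
      by (metis image_eqI insertCI reflection_reflection)
  qed
  then have "card (inversions (s \<circ> ?w)) \<le> card (insert (\<alpha> i) (s ` inversions ?w))"
    by (intro card_mono) (simp_all add: finite_inversions)
  also have "\<dots> \<le> Suc (card (inversions ?w))"
    using card_image_le[OF finite_inversions, of s ?w]
    by (simp add: card_insert_if finite_inversions)
  also have "card (inversions ?w) \<le> length ss" by (rule Cons.IH) (use Cons.prems in auto)
  finally have "card (inversions (s \<circ> ?w)) \<le> Suc (length ss)" by simp
  moreover have "foldr (\<circ>) (s # ss) id = s \<circ> ?w" by simp
  ultimately show ?case by (simp only: list.size)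
qed

lemma simple_reflection_parabolic:
  assumes "i \<in> {m..l}" "1 \<le> m"
  shows "reflection (\<alpha> i) \<in> parabolic m"
proof -
  have "reflection (\<alpha> i) (e j) = e j" if "j \<in> {1..<m}" for j
    using assms that by (auto simp: reflection_def B_simple_def inner_diff_left inner_e)
  then show ?thesis
    using assms reflection_signed_perm[OF simple_root[of i]] by (auto simp: parabolic_def)
qed

lemma parabolic_comp: "v \<in> parabolic m \<Longrightarrow> w \<in> parabolic m \<Longrightarrow> v \<circ> w \<in> parabolic m"
  by (simp add: parabolic_def signed_perm_comp)

lemma parabolic_id: "id \<in> parabolic m"
  by (simp add: parabolic_def signed_perm_id)

text \<open>If \<open>w\<close> is not the identity, then some simple root \<open>\<alpha> i\<close> with \<open>i \<ge> m\<close> is an inversion, by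
  \<open>dominant_imp_id\<close>. Composing with the corresponding reflection removes it and maps
  the others bijectively, so induction on the number of inversions yields a word.\<close>

lemma parabolic_word:
  assumes "w \<in> parabolic m" "1 \<le> m"
  shows "\<exists>ss. set ss \<subseteq> simple_reflections \<alpha> {m..l} \<and> length ss \<le> card (inversions w)
    \<and> foldr (\<circ>) ss id = w"
  using assms(1)
proof (induction "card (inversions w)" arbitrary: w rule: less_induct)
  case less
  show ?case
  proof (cases "\<forall>i\<in>{m..l}. \<alpha> i \<bullet> w \<rho> > 0")
    case True
    then have "w = id" using dominant_imp_id[OF less.prems assms(2)] by blast
    then show ?thesis by (intro exI[of _ "[]"]) simp
  next
    case False
    then obtain i where i: "i \<in> {m..l}" "\<alpha> i \<bullet> w \<rho> \<le> 0" by force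
    then have i1: "i \<in> {1..l}" using assms by simp
    let ?s = "reflection (\<alpha> i)"
    have neg: "\<alpha> i \<bullet> w \<rho> < 0"
      using i signed_perm_regular[OF parabolic_signed_perm[OF less.prems] simple_root[OF i1]]
      by linarith
    have s_simple: "?s (\<alpha> i) = - \<alpha> i"
      using simple_rho[OF i1] by (auto simp: reflection_def scaleR_2)
    have "?s ` inversions (?s \<circ> w) \<subseteq> inversions w - {\<alpha> i}"
    proof
      fix b assume "b \<in> ?s ` inversions (?s \<circ> w)"
      then obtain a where a: "b = ?s a" "a \<in> inversions (?s \<circ> w)" by blast
      have "a \<noteq> \<alpha> i"
      proof
        assume "a = \<alpha> i"
        then have "?s (\<alpha> i) \<bullet> w \<rho> < 0" using a by (simp add: inversions_def reflection_adjoint)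
        then show False using neg by (simp add: s_simple)
      qed
      moreover have "?s a \<noteq> \<alpha> i"
      proof
        assume "?s a = \<alpha> i"
        then have "a = - \<alpha> i" using s_simple by (metis reflection_reflection)
        then show False using a simple_rho[OF i1] by (simp add: inversions_def pos_roots_def)
      qed
      ultimately show "b \<in> inversions w - {\<alpha> i}" using inversions_reflect[OF i1] a by simp
    qed
    then have "card (?s ` inversions (?s \<circ> w)) \<le> card (inversions w - {\<alpha> i})"
      by (intro card_mono) (simp_all add: finite_inversions)
    moreover have "card (?s ` inversions (?s \<circ> w)) = card (inversions (?s \<circ> w))"
      by (intro card_image inj_on_inverseI[of _ ?s]) (simp add: reflection_reflection)
    moreover have "\<alpha> i \<in> inversions w"
      using neg simple_pos_root[OF i1] by (simp add: inversions_def)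
    then have "card (inversions w) = Suc (card (inversions w - {\<alpha> i}))"
      using finite_inversions by (metis card.remove)
    ultimately have card: "Suc (card (inversions (?s \<circ> w))) \<le> card (inversions w)" by simp
    have "?s \<circ> w \<in> parabolic m"
      using parabolic_comp simple_reflection_parabolic i(1) assms(2) less.prems by blast
    then obtain ss where ss: "set ss \<subseteq> simple_reflections \<alpha> {m..l}"
      "length ss \<le> card (inversions (?s \<circ> w))" "foldr (\<circ>) ss id = ?s \<circ> w"
      using less.hyps[of "?s \<circ> w"] card by auto
    have "?s \<circ> (?s \<circ> w) = w" by (auto simp: reflection_reflection)
    then show ?thesis
      using ss card i by (intro exI[of _ "?s # ss"]) (auto simp: simple_reflections_def)
  qed
qed

lemma word_length_eq_inversions:
  assumes "w \<in> signed_perms"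
  shows "word_length (simple_reflections \<alpha> {1..l}) w = card (inversions w)"
  unfolding word_length_def
proof (rule Least_equality)
  obtain ss where "set ss \<subseteq> simple_reflections \<alpha> {1..l}" "length ss \<le> card (inversions w)"
    "foldr (\<circ>) ss id = w" using parabolic_word[of w 1] assms parabolic_1 by auto
  then show "\<exists>ss. length ss = card (inversions w) \<and> set ss \<subseteq> simple_reflections \<alpha> {1..l}
      \<and> foldr (\<circ>) ss id = w"
    using word_inversions[of ss] by (intro exI[of _ ss]) auto
next
  fix n assume "\<exists>ss. length ss = n \<and> set ss \<subseteq> simple_reflections \<alpha> {1..l} \<and> foldr (\<circ>) ss id = w"
  then show "card (inversions w) \<le> n" using word_inversions by blast
qed

lemma generate_parabolic:
  assumes "1 \<le> m"
  shows "generate (BijGroup UNIV) (simple_reflections \<alpha> {m..l}) = parabolic m"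
proof
  have R: "simple_reflections \<alpha> {m..l} \<subseteq> range reflection" by (auto simp: simple_reflections_def)
  show "generate (BijGroup UNIV) (simple_reflections \<alpha> {m..l}) \<subseteq> parabolic m"
    using R simple_reflection_parabolic[OF _ assms] parabolic_id parabolic_comp
    by (intro generate_reflections_subset) (auto simp: simple_reflections_def)
  show "parabolic m \<subseteq> generate (BijGroup UNIV) (simple_reflections \<alpha> {m..l})"
    using parabolic_word[OF _ assms] word_in_generate[OF _ R] by blast
qed

lemma weyl_group_eq: "weyl_group \<Phi> = signed_perms"
proof
  show "weyl_group \<Phi> \<subseteq> signed_perms"
    unfolding weyl_group_def using reflection_signed_perm signed_perm_id signed_perm_comp
    by (intro generate_reflections_subset) auto
  have "simple_reflections \<alpha> {1..l} \<subseteq> reflection ` \<Phi>"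
    using simple_root by (auto simp: simple_reflections_def)
  moreover have "reflection ` \<Phi> \<subseteq> carrier (BijGroup (UNIV :: 'a set))"
    using signed_perm_bij[OF reflection_signed_perm] by (auto simp: BijGroup_def Bij_def)
  ultimately show "signed_perms \<subseteq> weyl_group \<Phi>"
    unfolding weyl_group_def parabolic_1[symmetric] generate_parabolic[symmetric, OF order.refl]
    by (intro group.mono_generate[OF group_BijGroup])
qed

section \<open>Longest elements\<close>

definition negate_from :: "nat \<Rightarrow> 'a \<Rightarrow> 'a" where
  "negate_from m x = x - 2 *\<^sub>R (\<Sum>k\<in>{m..l}. (e k \<bullet> x) *\<^sub>R e k)"

lemma coord_negate_from:
  assumes "k \<in> {1..l}" "1 \<le> m"
  shows "e k \<bullet> negate_from m x = (if m \<le> k then - (e k \<bullet> x) else e k \<bullet> x)"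
  using assms by (simp add: negate_from_def inner_diff_right coord_sum)

lemma negate_from_twice: "1 \<le> m \<Longrightarrow> negate_from m (negate_from m x) = x"
  by (rule coord_eqI) (simp add: coord_negate_from)

lemma negate_from_basis:
  assumes "k \<in> {1..l}" "1 \<le> m"
  shows "negate_from m (e k) = (if m \<le> k then - e k else e k)"
  using assms by (intro coord_eqI) (auto simp: coord_negate_from inner_e)

lemma negate_from_parabolic:
  assumes "1 \<le> m" "m \<le> l"
  shows "negate_from m \<in> parabolic m"
proof -
  have lin: "linear (negate_from m)"
    using assms(1) by (intro linearI coord_eqI) (simp_all add: coord_negate_from inner_add_right)
  have inner: "negate_from m x \<bullet> negate_from m y = x \<bullet> y" for x y
    unfolding inner_coords[of "negate_from m x"] inner_coords[of x]
    using assms(1) by (intro sum.cong) (simp_all add: coord_negate_from)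
  have "negate_from m b \<in> short_roots" if short: "b \<in> short_roots" for b
  proof -
    obtain s k where b: "b = s *\<^sub>R e k" "s = 1 \<or> s = -1" "k \<in> {1..l}" using short_rootE[OF short] .
    then have "negate_from m b = (if m \<le> k then - s else s) *\<^sub>R e k"
      using negate_from_basis[OF b(3) assms(1)] by (simp add: linear_scale[OF lin])
    then show ?thesis using short_rootI[of s k] short_rootI[of "- s" k] b
      by (cases "m \<le> k") fastforce+
  qed
  then have "negate_from m ` short_roots = short_roots"
    by (metis image_eqI image_subsetI negate_from_twice[OF assms(1)] subsetI subset_antisym)
  then show ?thesis
    using lin inner negate_from_basis assms
    by (simp add: parabolic_def signed_perms_def orthogonal_transformation_def)
qed

text \<open>A positive root whose first nonzero coordinate lies before \<open>m\<close> cannot be an inversion of \<open>v\<close>: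
  \<open>v \<rho>\<close> agrees with \<open>\<rho>\<close> there, and its later coordinates are smaller in absolute value. All other
  positive roots are made negative by the sign change.\<close>

lemma inversions_negate_from:
  assumes m: "1 \<le> m" "m \<le> l" and v: "v \<in> parabolic m"
  shows "inversions v \<subseteq> inversions (negate_from m)"
proof
  fix a assume "a \<in> inversions v"
  then have a: "a \<in> \<Phi>" "a \<bullet> \<rho> > 0" "a \<bullet> v \<rho> < 0"
    by (auto simp: inversions_def pos_roots_def)
  have low: "e j \<bullet> v \<rho> = real (l + 1 - j)" if "j \<in> {1..l}" "j < m" for j
    using parabolic_coord_fixed[OF v, of j \<rho>] coord_rho that by simp
  from a(1) have "a \<bullet> negate_from m \<rho> = - (a \<bullet> \<rho>)"
  proof (cases rule: rootE)
    case (1 s t j k)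
    have "\<not> j < m"
    proof
      assume jm: "j < m"
      have ht: "a \<bullet> \<rho> = s * real (l + 1 - j) + t * real (l + 1 - k)"
        and hv: "a \<bullet> v \<rho> = s * (e j \<bullet> v \<rho>) + t * (e k \<bullet> v \<rho>)"
        using 1 by (simp_all add: inner_add_left coord_rho)
      have lt: "real (l + 1 - k) < real (l + 1 - j)" "1 \<le> real (l + 1 - k)" using 1 by auto
      have s: "s = 1" using ht lt a(2) 1(2,3) by auto
      show False
      proof (cases "k < m")
        case True
        then show False using a ht hv low 1 jm by simp
      next
        case False
        then have "\<bar>e k \<bullet> v \<rho>\<bar> \<le> real (l + 1 - m)"
          using parabolic_coord_bound[OF v _ m(1), of k] 1 by simp
        moreover have "real (l + 1 - m) < real (l + 1 - j)" using jm 1 m by auto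
        ultimately show False using hv low[OF 1(4) jm] a(3) s 1(3) by auto
      qed
    qed
    then show ?thesis using 1 m by (simp add: inner_add_left coord_negate_from)
  next
    case (2 s k)
    have "\<not> k < m"
    proof
      assume "k < m"
      then have "a \<bullet> v \<rho> = a \<bullet> \<rho>" using 2 low coord_rho by simp
      then show False using a by simp
    qed
    then show ?thesis using 2 m by (simp add: coord_negate_from)
  qed
  then show "a \<in> inversions (negate_from m)"
    using a by (simp add: inversions_def pos_roots_def)
qed

text \<open>An element with as many inversions has the same inversions as the sign change. Then the composition
  of the two is positive on all simple roots from \<open>m\<close> on, hence it is the identity.\<close>

lemma longest_element_parabolic:
  assumes m: "1 \<le> m" "m \<le> l"
  shows "longest_element (simple_reflections \<alpha> {1..l}) (parabolic m) = negate_from m"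
proof -
  have len: "word_length (simple_reflections \<alpha> {1..l}) v = card (inversions v)"
    if "v \<in> parabolic m" for v
    using that word_length_eq_inversions parabolic_signed_perm by blast
  have nm: "negate_from m \<in> parabolic m" by (rule negate_from_parabolic[OF m])
  show ?thesis
    unfolding longest_element_def
  proof (rule the_equality)
    show "negate_from m \<in> parabolic m \<and> (\<forall>v\<in>parabolic m.
        word_length (simple_reflections \<alpha> {1..l}) v
          \<le> word_length (simple_reflections \<alpha> {1..l}) (negate_from m))"
      using nm len inversions_negate_from[OF m] by (simp add: card_mono finite_inversions)
  next
    fix w
    assume w: "w \<in> parabolic m \<and> (\<forall>v\<in>parabolic m.
        word_length (simple_reflections \<alpha> {1..l}) v \<le> word_length (simple_reflections \<alpha> {1..l}) w)"
    then have "card (inversions (negate_from m)) \<le> card (inversions w)"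
      using nm len by auto
    then have inv: "inversions w = inversions (negate_from m)"
      using w inversions_negate_from[OF m] finite_inversions by (intro card_seteq) auto
    have "negate_from m \<circ> w = id"
    proof (rule dominant_imp_id[OF _ m(1)])
      show "negate_from m \<circ> w \<in> parabolic m" using parabolic_comp nm w by blast
      fix i assume i: "i \<in> {m..l}"
      have "\<alpha> i \<bullet> negate_from m x = - (\<alpha> i \<bullet> x)" for x
        using i m by (auto simp: B_simple_def inner_diff_left coord_negate_from)
      moreover from this have "\<alpha> i \<in> inversions (negate_from m)"
        using i m simple_pos_root[of i] simple_rho[of i] by (simp add: inversions_def)
      then have "\<alpha> i \<bullet> w \<rho> < 0" unfolding inv[symmetric] by (simp add: inversions_def)
      ultimately show "0 < \<alpha> i \<bullet> (negate_from m \<circ> w) \<rho>" by simp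
    qed
    then show "w = negate_from m"
      using negate_from_twice[OF m(1)] by (metis comp_apply id_apply ext)
  qed
qed

lemma omega_1: "omega \<Phi> \<alpha> l 1 = reflection (e 1)"
proof -
  have "{1..l} - {1} = {2..l}" by auto
  then have "omega \<Phi> \<alpha> l 1 = negate_from 2 \<circ> negate_from 1"
    using longest_element_parabolic[of 1] longest_element_parabolic[of 2] rank
      generate_parabolic[of 2] weyl_group_eq parabolic_1
    by (simp add: omega_def)
  also have "\<dots> = reflection (e 1)"
  proof
    fix x
    have "e k \<bullet> (negate_from 2 \<circ> negate_from 1) x = e k \<bullet> reflection (e 1) x"
      if "k \<in> {1..l}" for k
      using that rank
      by (cases "k = 1") (auto simp: coord_negate_from reflection_def inner_diff_right inner_e)
    then show "(negate_from 2 \<circ> negate_from 1) x = reflection (e 1) x" by (rule coord_eqI)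
  qed
  finally show ?thesis .
qed


section \<open>The highest root\<close>

text \<open>The order in the definition of the highest root compares vectors whose difference lies in this cone.\<close>

definition simple_cone :: "'a set" where
  "simple_cone = {v. \<exists>n :: nat \<Rightarrow> nat. v = (\<Sum>i=1..l. real (n i) *\<^sub>R \<alpha> i)}"

lemma simple_cone_0: "0 \<in> simple_cone"
  unfolding simple_cone_def by (auto intro!: exI[of _ "\<lambda>_. 0"])

lemma simple_cone_simple: "i \<in> {1..l} \<Longrightarrow> \<alpha> i \<in> simple_cone"
  unfolding simple_cone_def
  by (auto intro!: exI[of _ "\<lambda>j. if j = i then 1 else 0"] simp: if_distrib[of "\<lambda>n. real n *\<^sub>R _"] cong: if_cong)

lemma simple_cone_add:
  assumes "v \<in> simple_cone" "w \<in> simple_cone"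
  shows "v + w \<in> simple_cone"
proof -
  obtain m n :: "nat \<Rightarrow> nat" where "v = (\<Sum>i=1..l. real (m i) *\<^sub>R \<alpha> i)"
    "w = (\<Sum>i=1..l. real (n i) *\<^sub>R \<alpha> i)" using assms unfolding simple_cone_def by blast
  then have "v + w = (\<Sum>i=1..l. real (m i + n i) *\<^sub>R \<alpha> i)"
    by (simp add: sum.distrib scaleR_left_distrib)
  then show ?thesis
    unfolding simple_cone_def by (intro CollectI exI[of _ "\<lambda>i. m i + n i"])
qed

text \<open>Nonnegative combinations of simple roots have nonnegative height, and the height is the sum of the
  coefficients.\<close>

lemma simple_cone_pointed:
  assumes "v \<in> simple_cone" "- v \<in> simple_cone"
  shows "v = 0"
proof -
  have ht: "(\<Sum>i=1..l. real (n i) *\<^sub>R \<alpha> i) \<bullet> \<rho> = (\<Sum>i=1..l. real (n i))" for n :: "nat \<Rightarrow> nat"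
    unfolding inner_sum_left by (intro sum.cong) (simp_all add: simple_rho)
  obtain m n :: "nat \<Rightarrow> nat" where v: "v = (\<Sum>i=1..l. real (m i) *\<^sub>R \<alpha> i)"
    and "- v = (\<Sum>i=1..l. real (n i) *\<^sub>R \<alpha> i)" using assms unfolding simple_cone_def by blast
  then have "(- v) \<bullet> \<rho> \<ge> 0" using ht[of n] by (simp add: sum_nonneg)
  then have "(\<Sum>i=1..l. real (m i)) \<le> 0" using ht[of m] v by simp
  moreover have "(\<Sum>i=1..l. real (m i)) \<ge> 0" by (simp add: sum_nonneg)
  ultimately have "(\<Sum>i=1..l. real (m i)) = 0" by linarith
  then have "\<forall>i\<in>{1..l}. real (m i) = 0" by (subst (asm) sum_nonneg_eq_0_iff) auto
  then show ?thesis unfolding v by (intro sum.neutral) auto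
qed

lemma simple_cone_e:
  assumes "k \<le> l" "1 \<le> k"
  shows "e k \<in> simple_cone"
  using assms
proof (induction k rule: inc_induct)
  case base
  then show ?case using simple_cone_simple[of l] by (simp add: B_simple_def)
next
  case (step k)
  then have "\<alpha> k + e (Suc k) \<in> simple_cone" by (intro simple_cone_add simple_cone_simple) auto
  then show ?case using step by (simp add: B_simple_def)
qed

lemma simple_cone_diff:
  assumes "i \<le> k" "k \<le> l" "1 \<le> i"
  shows "e i - e k \<in> simple_cone"
  using assms
proof (induction k rule: dec_induct)
  case base
  then show ?case using simple_cone_0 by simp
next
  case (step k)
  then have "(e i - e k) + \<alpha> k \<in> simple_cone" by (intro simple_cone_add simple_cone_simple) auto
  then show ?case using step by (simp add: B_simple_def)
qed

text \<open>Every root \<open>c\<close> lies below \<open>e 1 + e 2\<close>, since \<open>e i \<plusminus> e k\<close> lies in the cone whenever \<open>i \<le> k\<close>.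
  Uniqueness holds because the cone contains no line.\<close>

lemma highest_root_eq: "highest_root \<Phi> \<alpha> l = e 1 + e 2"
proof -
  have dominates: "e 1 + e 2 - c \<in> simple_cone" if "c \<in> \<Phi>" for c
  proof -
    have sub: "e i - s *\<^sub>R e k \<in> simple_cone" if "s = 1 \<or> s = -1" "1 \<le> i" "i \<le> k" "k \<le> l" for i k s
      using simple_cone_diff[of i k] simple_cone_add[OF simple_cone_e[of i] simple_cone_e[of k]] that
      by auto
    from that show ?thesis
    proof (cases rule: rootE)
      case (1 s t i k)
      then have "(e 1 - s *\<^sub>R e i) + (e 2 - t *\<^sub>R e k) \<in> simple_cone"
        by (intro simple_cone_add sub) auto
      then show ?thesis using 1 by (simp add: algebra_simps)
    next
      case (2 s k)
      then have "(e 1 - s *\<^sub>R e k) + e 2 \<in> simple_cone"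
        using rank by (intro simple_cone_add sub simple_cone_e) auto
      then show ?thesis using 2 by (simp add: algebra_simps)
    qed
  qed
  have root: "e 1 + e 2 \<in> \<Phi>" using long_rootI[of 1 1 1 2] rank by simp
  show ?thesis
    unfolding highest_root_def
  proof (rule the_equality)
    show "e 1 + e 2 \<in> \<Phi> \<and> (\<forall>c\<in>\<Phi>. \<exists>n :: nat \<Rightarrow> nat. e 1 + e 2 - c = (\<Sum>i=1..l. real (n i) *\<^sub>R \<alpha> i))"
      using root dominates unfolding simple_cone_def by blast
  next
    fix b
    assume b: "b \<in> \<Phi> \<and> (\<forall>c\<in>\<Phi>. \<exists>n :: nat \<Rightarrow> nat. b - c = (\<Sum>i=1..l. real (n i) *\<^sub>R \<alpha> i))"
    then have "b - (e 1 + e 2) \<in> simple_cone" using root unfolding simple_cone_def by blast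
    moreover have "- (b - (e 1 + e 2)) \<in> simple_cone" using dominates[of b] b by simp
    ultimately show "b = e 1 + e 2" using simple_cone_pointed by fastforce
  qed
qed

section \<open>The alcove, the coweight lattice and its cosets\<close>

lemma fund_alcove_iff:
  "x \<in> fund_alcove \<Phi> \<alpha> l \<longleftrightarrow>
    (\<forall>k\<in>{1..<l}. e (Suc k) \<bullet> x < e k \<bullet> x) \<and> e l \<bullet> x > 0 \<and> e 1 \<bullet> x + e 2 \<bullet> x < 1"
proof -
  have "(\<forall>i\<in>{1..l}. \<alpha> i \<bullet> x > 0) \<longleftrightarrow> (\<forall>i\<in>{1..<l}. \<alpha> i \<bullet> x > 0) \<and> \<alpha> l \<bullet> x > 0"
    using rank by (metis (no_types, opaque_lifting) One_nat_def Suc_leD atLeastAtMost_iff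
        atLeastLessThan_iff le_neq_implies_less less_or_eq_imp_le numeral_2_eq_2 order_refl)
  then show ?thesis
    by (auto simp: fund_alcove_def highest_root_eq inner_add_left B_simple_def inner_diff_left)
qed

lemma fund_alcove_coord:
  assumes x: "x \<in> fund_alcove \<Phi> \<alpha> l" and k: "2 \<le> k" "k \<le> l"
  shows "0 < e k \<bullet> x" "e k \<bullet> x \<le> e 2 \<bullet> x"
proof -
  have drop: "e (Suc j) \<bullet> x < e j \<bullet> x" if "1 \<le> j" "j < l" for j
    using x that by (auto simp: fund_alcove_iff)
  show "0 < e k \<bullet> x"
    using k(2,1)
  proof (induction k rule: inc_induct)
    case base
    then show ?case using x by (simp add: fund_alcove_iff)
  next
    case (step j)
    then show ?case using drop[of j] by simp
  qed
  show "e k \<bullet> x \<le> e 2 \<bullet> x"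
    using k
  proof (induction k rule: dec_induct)
    case base
    then show ?case by simp
  next
    case (step j)
    then show ?case using drop[of j] by simp
  qed
qed

abbreviation "Z \<equiv> coweight_lattice \<Phi>"

lemma coweight_lattice_coords: "x \<in> Z \<longleftrightarrow> (\<forall>k\<in>{1..l}. e k \<bullet> x \<in> \<int>)"
proof
  assume "x \<in> Z"
  moreover have "e k \<in> \<Phi>" if "k \<in> {1..l}" for k using e_short_root[OF that] roots_eq by blast
  ultimately show "\<forall>k\<in>{1..l}. e k \<bullet> x \<in> \<int>" by (simp add: coweight_lattice_def)
next
  assume int: "\<forall>k\<in>{1..l}. e k \<bullet> x \<in> \<int>"
  have "a \<bullet> x \<in> \<int>" if "a \<in> \<Phi>" for a
    using that
  proof (cases rule: rootE)
    case (1 s t i k)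
    then have "s \<in> \<int>" "t \<in> \<int>" by auto
    then show ?thesis using 1 int by (simp add: inner_add_left)
  next
    case (2 s k)
    then have "s \<in> \<int>" by auto
    then show ?thesis using 2 int by simp
  qed
  then show "x \<in> Z" by (simp add: coweight_lattice_def)
qed

lemma coweight_lattice_add: "x \<in> Z \<Longrightarrow> y \<in> Z \<Longrightarrow> x + y \<in> Z"
  and coweight_lattice_uminus: "x \<in> Z \<Longrightarrow> - x \<in> Z"
  and coweight_lattice_0: "0 \<in> Z"
  by (simp_all add: coweight_lattice_def inner_add_right)

lemma coweight_lattice_signed_perm:
  assumes "w \<in> signed_perms"
  shows "w ` Z = Z"
proof -
  have iff: "w y \<in> Z \<longleftrightarrow> y \<in> Z" for y
  proof -
    have "w y \<in> Z \<longleftrightarrow> (\<forall>a\<in>w ` \<Phi>. a \<bullet> w y \<in> \<int>)"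
      by (simp add: coweight_lattice_def signed_perm_roots[OF assms])
    also have "\<dots> \<longleftrightarrow> y \<in> Z" by (simp add: coweight_lattice_def signed_perm_inner[OF assms])
    finally show ?thesis .
  qed
  have "\<exists>y. x = w y" for x using signed_perm_bij[OF assms] by (metis bij_pointE)
  then show ?thesis using iff by (metis image_eqI image_subsetI subsetI subset_antisym)
qed

lemma coset_eq_iff:
  "coset_mod Z q x = coset_mod Z q y \<longleftrightarrow> (\<exists>z\<in>Z. y = x + real q *\<^sub>R z)"
proof
  assume "coset_mod Z q x = coset_mod Z q y"
  moreover have "y \<in> coset_mod Z q y"
    using coweight_lattice_0 unfolding coset_mod_def by force
  ultimately show "\<exists>z\<in>Z. y = x + real q *\<^sub>R z" by (auto simp: coset_mod_def)
next
  assume "\<exists>z\<in>Z. y = x + real q *\<^sub>R z"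
  then obtain z where z: "z \<in> Z" "y = x + real q *\<^sub>R z" by blast
  have "x + real q *\<^sub>R c = y + real q *\<^sub>R (c + - z)" "y + real q *\<^sub>R c = x + real q *\<^sub>R (z + c)" for c
    unfolding z(2) by (simp_all add: algebra_simps)
  then have "x + real q *\<^sub>R c \<in> coset_mod Z q y" "y + real q *\<^sub>R c \<in> coset_mod Z q x" if "c \<in> Z" for c
    unfolding coset_mod_def using that z(1) coweight_lattice_add coweight_lattice_uminus
    by (metis imageI)+
  then show "coset_mod Z q x = coset_mod Z q y" by (auto simp: coset_mod_def)
qed

lemma coset_eq_iff_coords:
  "coset_mod Z q x = coset_mod Z q y \<longleftrightarrow>
    (\<forall>k\<in>{1..l}. \<exists>m::int. e k \<bullet> y - e k \<bullet> x = real q * of_int m)"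
proof
  assume "coset_mod Z q x = coset_mod Z q y"
  then obtain z where z: "z \<in> Z" "y = x + real q *\<^sub>R z" using coset_eq_iff by blast
  show "\<forall>k\<in>{1..l}. \<exists>m::int. e k \<bullet> y - e k \<bullet> x = real q * of_int m"
  proof
    fix k assume "k \<in> {1..l}"
    then obtain m where "e k \<bullet> z = of_int m" using z coweight_lattice_coords by (metis Ints_cases)
    then show "\<exists>m::int. e k \<bullet> y - e k \<bullet> x = real q * of_int m"
      using z by (auto simp: inner_add_right)
  qed
next
  assume "\<forall>k\<in>{1..l}. \<exists>m::int. e k \<bullet> y - e k \<bullet> x = real q * of_int m"
  then obtain m :: "nat \<Rightarrow> int" where m: "\<And>k. k \<in> {1..l} \<Longrightarrow> e k \<bullet> y - e k \<bullet> x = real q * of_int (m k)"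
    by metis
  define z where "z = (\<Sum>k\<in>{1..l}. of_int (m k) *\<^sub>R e k)"
  have z: "e k \<bullet> z = of_int (m k)" if "k \<in> {1..l}" for k
    using that coord_sum[of k "{1..l}" "\<lambda>k. of_int (m k)"] by (simp add: z_def)
  then have "z \<in> Z" by (simp add: coweight_lattice_coords)
  moreover have "y = x + real q *\<^sub>R z"
  proof (rule coord_eqI)
    fix k assume "k \<in> {1..l}"
    then show "e k \<bullet> y = e k \<bullet> (x + real q *\<^sub>R z)" using m[of k] z[of k] by (simp add: inner_add_right)
  qed
  ultimately show "coset_mod Z q x = coset_mod Z q y" using coset_eq_iff by blast
qed

lemma signed_perm_coset:
  assumes "w \<in> signed_perms"
  shows "w ` coset_mod Z q x = coset_mod Z q (w x)"
proof -
  have "w ` coset_mod Z q x = (\<lambda>z. w x + real q *\<^sub>R w z) ` Z"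
    using linear_add[OF signed_perm_linear[OF assms]] linear_scale[OF signed_perm_linear[OF assms]]
    by (simp add: coset_mod_def image_image)
  also have "\<dots> = coset_mod Z q (w x)"
    unfolding coset_mod_def image_image
    by (subst (2) coweight_lattice_signed_perm[OF assms, symmetric]) (simp add: image_image)
  finally show ?thesis .
qed

section \<open>The stabilizer of the alcove\<close>

lemma reflection_e1_signed_perm: "reflection (e 1) \<in> signed_perms"
  using reflection_signed_perm e_short_root[of 1] rank roots_eq by auto

lemma coord_reflection_e1:
  "k \<in> {1..l} \<Longrightarrow> e k \<bullet> reflection (e 1) x = (if k = 1 then - (e 1 \<bullet> x) else e k \<bullet> x)"
  using rank by (auto simp: reflection_def inner_diff_right inner_e)

text \<open>The map \<open>x\<^sub>1 \<mapsto> 1 - x\<^sub>1\<close> exchanges the two conditions \<open>x\<^sub>2 < x\<^sub>1\<close> and \<open>x\<^sub>1 + x\<^sub>2 < 1\<close>; this is the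
  symmetry of the affine Dynkin diagram.\<close>

lemma reflect_fund_alcove:
  assumes "x \<in> fund_alcove \<Phi> \<alpha> l"
  shows "reflection (e 1) x + e 1 \<in> fund_alcove \<Phi> \<alpha> l"
proof -
  have c: "e k \<bullet> (reflection (e 1) x + e 1) = (if k = 1 then 1 - e 1 \<bullet> x else e k \<bullet> x)"
    if "k \<in> {1..l}" for k
    using that rank coord_reflection_e1[OF that] by (auto simp: inner_add_right inner_e)
  show ?thesis
    unfolding fund_alcove_iff
  proof (intro conjI ballI)
    fix k assume "k \<in> {1..<l}"
    then show "e (Suc k) \<bullet> (reflection (e 1) x + e 1) < e k \<bullet> (reflection (e 1) x + e 1)"
      using assms c[of k] c[of "Suc k"] by (cases "k = 1") (auto simp: fund_alcove_iff numeral_2_eq_2)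
  next
    show "0 < e l \<bullet> (reflection (e 1) x + e 1)"
      using assms c[of l] rank by (simp add: fund_alcove_iff)
  next
    have "e 2 \<bullet> x < e 1 \<bullet> x" using assms rank by (auto simp: fund_alcove_iff numeral_2_eq_2)
    then show "e 1 \<bullet> (reflection (e 1) x + e 1) + e 2 \<bullet> (reflection (e 1) x + e 1) < 1"
      using c[of 1] c[of 2] rank by simp
  qed
qed

lemma reflection_e1_stabilizes: "reflection (e 1) \<in> alcove_stabilizer \<Phi> \<alpha> l"
proof -
  let ?r = "reflection (e 1)" and ?A = "alcove_image \<Phi> \<alpha> l"
  have maps: "?r ` t \<in> ?A" if t: "t \<in> ?A" for t
  proof -
    obtain x where x: "x \<in> fund_alcove \<Phi> \<alpha> l" "t = coset_mod Z 1 x"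
      using t unfolding alcove_image_def by blast
    have "e 1 \<in> Z" using rank by (auto simp: coweight_lattice_coords inner_e)
    then have "coset_mod Z 1 (?r x) = coset_mod Z 1 (?r x + e 1)" by (auto simp: coset_eq_iff)
    then show ?thesis
      using x reflect_fund_alcove[OF x(1)] signed_perm_coset[OF reflection_e1_signed_perm]
      by (auto simp: alcove_image_def)
  qed
  moreover have "?r ` ?r ` t = t" for t by (simp add: image_image reflection_reflection)
  ultimately have "(\<lambda>t. ?r ` t) ` ?A = ?A"
    by (metis image_eqI image_subsetI subsetI subset_antisym)
  then show ?thesis
    using reflection_e1_signed_perm by (simp add: alcove_stabilizer_def weyl_group_eq)
qed

text \<open>All simple roots take the value \<open>1 / (2 l)\<close> here, and so does 1 minus the highest root. The
  denominator is the Coxeter number.\<close>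

definition center :: 'a where
  "center = (1 / (2 * real l)) *\<^sub>R \<rho>"

lemma center_fund_alcove: "center \<in> fund_alcove \<Phi> \<alpha> l"
proof -
  have c: "e k \<bullet> center = real (l + 1 - k) / (2 * real l)" if "k \<in> {1..l}" for k
    using coord_rho[OF that] by (simp add: center_def)
  show ?thesis
    unfolding fund_alcove_iff
  proof (intro conjI ballI)
    fix k assume "k \<in> {1..<l}"
    then show "e (Suc k) \<bullet> center < e k \<bullet> center"
      using c[of k] c[of "Suc k"] rank by (auto intro!: divide_strict_right_mono)
  next
    show "0 < e l \<bullet> center" using c[of l] rank by simp
  next
    have "e 1 \<bullet> center = 1 / 2" using c[of 1] rank by simp
    moreover have "e 2 \<bullet> center = (real l - 1) / (2 * real l)"
      using c[of 2] rank by (simp add: of_nat_diff)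
    moreover have "(real l - 1) / (2 * real l) < 1 / 2" using rank by (simp add: field_simps)
    ultimately show "e 1 \<bullet> center + e 2 \<bullet> center < 1" by linarith
  qed
qed

lemma signed_perm_center:
  assumes "w \<in> signed_perms" "w center \<in> fund_alcove \<Phi> \<alpha> l"
  shows "w = id"
proof (rule dominant_imp_id[of _ 1])
  fix i assume i: "i \<in> {1..l}"
  have "w center = (1 / (2 * real l)) *\<^sub>R w \<rho>"
    unfolding center_def by (rule linear_scale[OF signed_perm_linear[OF assms(1)]])
  moreover have "\<alpha> i \<bullet> w center > 0" using assms(2) i by (simp add: fund_alcove_def)
  ultimately show "\<alpha> i \<bullet> w \<rho> > 0" using rank by (simp add: zero_less_mult_iff zero_less_divide_iff)
qed (use assms in \<open>simp_all add: parabolic_1[unfolded One_nat_def]\<close>)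

text \<open>Let \<open>w\<close> stabilize the image of the alcove, and let \<open>z\<close> be a vector of the alcove congruent to
  \<open>w center\<close>. All coordinates of \<open>w center\<close> lie in \<open>[-1/2, 1/2]\<close>, and those of \<open>z\<close> lie in
  \<open>(0, 1/2)\<close>, except that the first one lies in \<open>(0, 1)\<close>. So the two vectors agree except possibly in
  the first coordinate, where the difference is 0 or 1. If it is 0, then \<open>w center\<close> lies in the
  alcove; if it is 1, then its reflection does.\<close>

lemma alcove_stabilizer_eq: "alcove_stabilizer \<Phi> \<alpha> l = {id, reflection (e 1)}"
proof
  have "id \<in> alcove_stabilizer \<Phi> \<alpha> l"
    by (simp add: alcove_stabilizer_def weyl_group_eq signed_perm_id)
  then show "{id, reflection (e 1)} \<subseteq> alcove_stabilizer \<Phi> \<alpha> l" using reflection_e1_stabilizes by simp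
next
  show "alcove_stabilizer \<Phi> \<alpha> l \<subseteq> {id, reflection (e 1)}"
  proof
    fix w assume "w \<in> alcove_stabilizer \<Phi> \<alpha> l"
    then have w: "w \<in> signed_perms" and
      im: "(\<lambda>t. w ` t) ` alcove_image \<Phi> \<alpha> l = alcove_image \<Phi> \<alpha> l"
      by (auto simp: alcove_stabilizer_def weyl_group_eq)
    let ?r = "reflection (e 1)"
    have "coset_mod Z 1 center \<in> alcove_image \<Phi> \<alpha> l"
      using center_fund_alcove by (simp add: alcove_image_def)
    then have "coset_mod Z 1 (w center) \<in> alcove_image \<Phi> \<alpha> l"
      using im signed_perm_coset[OF w] by (metis imageI)
    then obtain z where z: "z \<in> fund_alcove \<Phi> \<alpha> l" "coset_mod Z 1 (w center) = coset_mod Z 1 z"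
      by (auto simp: alcove_image_def)
    have diff: "\<exists>m::int. e k \<bullet> z - e k \<bullet> w center = of_int m" if "k \<in> {1..l}" for k
      using z(2) that by (simp add: coset_eq_iff_coords)
    have bound: "\<bar>e k \<bullet> w center\<bar> \<le> 1 / 2" if "k \<in> {1..l}" for k
    proof -
      have "\<bar>e k \<bullet> w \<rho>\<bar> \<le> real l"
        using parabolic_coord_bound[of w 1 k] w that by (simp add: parabolic_1[unfolded One_nat_def])
      moreover have "w center = (1 / (2 * real l)) *\<^sub>R w \<rho>"
        unfolding center_def by (rule linear_scale[OF signed_perm_linear[OF w]])
      ultimately show ?thesis using rank by (simp add: field_simps abs_mult)
    qed
    have z12: "e 2 \<bullet> z < e 1 \<bullet> z" "e 1 \<bullet> z + e 2 \<bullet> z < 1" "0 < e 2 \<bullet> z"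
      using z(1) rank fund_alcove_coord[OF z(1), of 2] by (auto simp: fund_alcove_iff numeral_2_eq_2)
    have same: "e k \<bullet> w center = e k \<bullet> z" if k: "k \<in> {1..l}" "k \<noteq> 1" for k
    proof -
      obtain m :: int where m: "e k \<bullet> z - e k \<bullet> w center = of_int m" using diff[OF k(1)] ..
      have "0 < e k \<bullet> z" "e k \<bullet> z < 1 / 2" using fund_alcove_coord[OF z(1), of k] k z12 by auto
      then have "-1 < (of_int m :: real)" "(of_int m :: real) < 1" using m bound[OF k(1)] by linarith+
      then have "m = 0" by linarith
      then show ?thesis using m by simp
    qed
    obtain m :: int where m: "e 1 \<bullet> z - e 1 \<bullet> w center = of_int m" using diff[of 1] rank by auto
    have "-1 < (of_int m :: real)" "(of_int m :: real) < 2" using m bound[of 1] z12 rank by auto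
    then consider "m = 0" | "m = 1" by linarith
    then show "w \<in> {id, ?r}"
    proof cases
      case 1
      have "e k \<bullet> w center = e k \<bullet> z" if "k \<in> {1..l}" for k
        using same[OF that] m 1 by (cases "k = 1") auto
      then have "w center = z" by (rule coord_eqI)
      then show ?thesis using signed_perm_center[OF w] z by simp
    next
      case 2
      have "e k \<bullet> ?r (w center) = e k \<bullet> (?r z + e 1)" if "k \<in> {1..l}" for k
        unfolding inner_add_right coord_reflection_e1[OF that]
        using same[OF that] m 2 that rank by (cases "k = 1") (auto simp: inner_e)
      then have "(?r \<circ> w) center = ?r z + e 1" unfolding o_apply by (rule coord_eqI)
      then have "?r \<circ> w = id"
        using signed_perm_center[of "?r \<circ> w"] signed_perm_comp[OF reflection_e1_signed_perm w]
          reflect_fund_alcove[OF z(1)] by simp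
      then have "w = ?r" by (metis comp_apply ext id_apply reflection_reflection)
      then show ?thesis by simp
    qed
  qed
qed


section \<open>Counting fixed cosets\<close>

text \<open>The list starts at index 0, the coordinates start at 1.\<close>

definition lattice_vector :: "nat list \<Rightarrow> 'a" where
  "lattice_vector xs = (\<Sum>k=1..l. real (xs ! (k - 1)) *\<^sub>R e k)"

lemma coord_lattice_vector: "k \<in> {1..l} \<Longrightarrow> e k \<bullet> lattice_vector xs = real (xs ! (k - 1))"
  unfolding lattice_vector_def by (subst coord_sum) auto

lemma regular_coset_cong:
  assumes "coset_mod Z q x = coset_mod Z q y" "b \<in> \<Phi>"
  shows "(\<exists>k::int. b \<bullet> x = real q * of_int k) \<longleftrightarrow> (\<exists>k::int. b \<bullet> y = real q * of_int k)"
proof -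
  obtain z where z: "z \<in> Z" "y = x + real q *\<^sub>R z" using assms(1) coset_eq_iff by blast
  then obtain m where m: "b \<bullet> z = of_int m" using assms(2) by (auto simp: coweight_lattice_def elim: Ints_cases)
  have "b \<bullet> x = real q * of_int k \<longleftrightarrow> b \<bullet> y = real q * of_int (k + m)" for k
    using z m by (simp add: inner_add_right algebra_simps)
  then show ?thesis by (metis diff_add_cancel)
qed

text \<open>The roots \<open>\<plusminus> e k\<close> exclude the residue 0, the roots \<open>\<plusminus> (e i - e k)\<close> exclude equal residues, and the
  roots \<open>\<plusminus> (e i + e k)\<close> exclude opposite ones. The bounds on the entries turn congruences into
  equations.\<close>

lemma lattice_vector_regular_iff:
  assumes xs: "length xs = l" "set xs \<subseteq> {0..<q}"
  shows "(\<forall>b\<in>\<Phi>. \<not> (\<exists>k::int. b \<bullet> lattice_vector xs = real q * of_int k)) \<longleftrightarrow> xs \<in> regular_lists q l"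
    (is "?regular \<longleftrightarrow> _")
proof
  define x where "x k = int (xs ! (k - 1))" for k
  have coord: "e k \<bullet> lattice_vector xs = of_int (x k)" if "k \<in> {1..l}" for k
    using coord_lattice_vector[OF that] by (simp add: x_def)
  have bound: "0 \<le> x k" "x k < int q" if "k \<in> {1..l}" for k
  proof -
    have "xs ! (k - 1) \<in> set xs" using that xs by auto
    then show "0 \<le> x k" "x k < int q" using xs(2) by (auto simp: x_def)
  qed
  {
    assume reg: ?regular
    have long: "\<not> int q dvd x i + t * x k"
      if "i \<in> {1..l}" "k \<in> {1..l}" "i < k" "t = 1 \<or> t = -1" for i k t
    proof -
      let ?b = "1 *\<^sub>R e i + real_of_int t *\<^sub>R e k"
      have "?b \<bullet> lattice_vector xs = of_int (x i + t * x k)" using that coord by (simp add: inner_add_left)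
      moreover have "?b \<in> \<Phi>" using that by (intro long_rootI) auto
      ultimately show ?thesis using reg multiple_iff_dvd by blast
    qed
    have short: "\<not> int q dvd x k" if "k \<in> {1..l}" for k
    proof -
      have "e k \<in> \<Phi>" using e_short_root[OF that] roots_eq by blast
      then show ?thesis using reg multiple_iff_dvd[OF coord[OF that]] by blast
    qed
    have "set xs \<subseteq> {1..<q}"
    proof
      fix y assume "y \<in> set xs"
      then obtain j where j: "j < l" "y = xs ! j" using xs by (metis in_set_conv_nth)
      then have "\<not> int q dvd int y" using short[of "Suc j"] by (simp add: x_def)
      then have "y \<noteq> 0" by (cases y) auto
      then show "y \<in> {1..<q}" using \<open>y \<in> set xs\<close> xs(2) by auto
    qed
    moreover have "xs ! k \<noteq> xs ! i \<and> xs ! k \<noteq> q - xs ! i" if "i < k" "k < l" for i k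
    proof -
      have "\<not> int q dvd int (xs ! i) - int (xs ! k)" "\<not> int q dvd int (xs ! i) + int (xs ! k)"
        using long[of "Suc i" "Suc k" "-1"] long[of "Suc i" "Suc k" 1] that by (simp_all add: x_def)
      moreover have "xs ! i < q" using that xs nth_mem[of i xs] by fastforce
      ultimately show ?thesis by (auto simp: of_nat_diff)
    qed
    ultimately show "xs \<in> regular_lists q l"
      using xs by (simp add: avoiding_lists_def sorted_wrt_iff_nth_less)
  }
  assume reg: "xs \<in> regular_lists q l"
  have pos: "0 < x k" if "k \<in> {1..l}" for k
  proof -
    have "xs ! (k - 1) \<in> set xs" using that xs by auto
    then show ?thesis using reg by (auto simp: x_def avoiding_lists_def)
  qed
  have distinct: "x i \<noteq> x k" "x i + x k \<noteq> int q" if "i \<in> {1..l}" "k \<in> {1..l}" "i < k" for i k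
  proof -
    have "i - 1 < k - 1" "k - 1 < length xs" using that xs by auto
    then have "xs ! (k - 1) \<noteq> xs ! (i - 1) \<and> xs ! (k - 1) \<noteq> q - xs ! (i - 1)"
      using reg by (auto simp: avoiding_lists_def sorted_wrt_iff_nth_less)
    then show "x i \<noteq> x k" "x i + x k \<noteq> int q" by (auto simp: x_def)
  qed
  have small: "d = 0" if "int q dvd d" "\<bar>d\<bar> < int q" for d
    using that dvd_imp_le_int[of d "int q"] by auto
  show ?regular
  proof
    fix b assume "b \<in> \<Phi>"
    then show "\<not> (\<exists>k::int. b \<bullet> lattice_vector xs = real q * of_int k)"
    proof (cases rule: rootE)
      case (1 s t i k)
      have sum: "\<not> int q dvd x i + x k"
      proof
        assume "int q dvd x i + x k"
        then have "int q dvd x i + x k - int q" by simp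
        then have "x i + x k - int q = 0"
          using bound[of i] bound[of k] pos[of i] pos[of k] 1 by (intro small) auto
        then show False using distinct[of i k] 1 by simp
      qed
      have diff: "\<not> int q dvd x i - x k"
      proof
        assume "int q dvd x i - x k"
        moreover have "\<bar>x i - x k\<bar> < int q"
          using bound[OF 1(4)] bound[OF 1(5)] by linarith
        ultimately show False using small distinct(1)[OF 1(4-6)] by fastforce
      qed
      have "\<not> int q dvd - x i - x k" "\<not> int q dvd - x i + x k"
        using sum diff by (metis dvd_minus_iff minus_add_distrib uminus_add_conv_diff diff_conv_add_uminus minus_diff_eq)+
      moreover have "b \<bullet> lattice_vector xs = s * of_int (x i) + t * of_int (x k)"
        using 1 coord by (simp add: inner_add_left)
      ultimately show ?thesis
        using 1(2,3) sum diff multiple_iff_dvd[of _ "x i + x k"] multiple_iff_dvd[of _ "x i - x k"]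
          multiple_iff_dvd[of _ "- x i + x k"] multiple_iff_dvd[of _ "- x i - x k"]
        by (elim disjE) simp_all
    next
      case (2 s k)
      have "\<not> int q dvd x k" using small[of "x k"] pos[of k] bound[of k] 2 by auto
      moreover have "b \<bullet> lattice_vector xs = s * of_int (x k)" using 2 coord by simp
      ultimately show ?thesis
        using 2(2) multiple_iff_dvd[of _ "x k"] multiple_iff_dvd[of _ "- x k"] by (elim disjE) simp_all
    qed
  qed
qed

text \<open>Each coset of \<open>qZ\<close> contains exactly one vector with all coordinates in \<open>{0, \<dots>, q - 1}\<close>, and
  regularity depends on the coset only.\<close>

lemma regular_cosets_eq:
  assumes "q > 0"
  shows "regular_cosets \<Phi> q = (\<lambda>xs. coset_mod Z q (lattice_vector xs)) ` regular_lists q l"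
proof (intro equalityI subsetI)
  fix t assume "t \<in> regular_cosets \<Phi> q"
  then obtain x where x: "x \<in> Z" "\<forall>b\<in>\<Phi>. \<not> (\<exists>k::int. b \<bullet> x = real q * of_int k)" "t = coset_mod Z q x"
    by (auto simp: regular_cosets_def)
  define z where "z k = \<lfloor>e k \<bullet> x\<rfloor>" for k
  have z: "e k \<bullet> x = of_int (z k)" if "k \<in> {1..l}" for k
    using x(1) that by (auto simp: coweight_lattice_coords z_def)
  define xs where "xs = map (\<lambda>k. nat (z (Suc k) mod int q)) [0..<l]"
  have xs: "length xs = l" "set xs \<subseteq> {0..<q}"
    using assms by (auto simp: xs_def nat_less_iff)
  have "coset_mod Z q x = coset_mod Z q (lattice_vector xs)"
    unfolding coset_eq_iff_coords
  proof
    fix k assume k: "k \<in> {1..l}"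
    then obtain j where j: "k = Suc j" "j < l" by (cases k) auto
    then have "real (xs ! (k - 1)) = of_int (z k mod int q)" using assms by (simp add: xs_def)
    then have "e k \<bullet> lattice_vector xs - e k \<bullet> x = of_int (z k mod int q - z k)"
      using k z coord_lattice_vector by simp
    also have "z k mod int q - z k = int q * - (z k div int q)"
      by (simp add: minus_div_mult_eq_mod[symmetric])
    finally show "\<exists>m::int. e k \<bullet> lattice_vector xs - e k \<bullet> x = real q * of_int m"
      by (metis of_int_mult of_int_of_nat_eq)
  qed
  moreover from this have "xs \<in> regular_lists q l"
    using lattice_vector_regular_iff[OF xs] regular_coset_cong x(2) by blast
  ultimately show "t \<in> (\<lambda>xs. coset_mod Z q (lattice_vector xs)) ` regular_lists q l"
    using x(3) by blast
next
  fix t assume "t \<in> (\<lambda>xs. coset_mod Z q (lattice_vector xs)) ` regular_lists q l"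
  then obtain xs where xs: "xs \<in> regular_lists q l" "t = coset_mod Z q (lattice_vector xs)" by blast
  then have "length xs = l" "set xs \<subseteq> {0..<q}" by (auto simp: avoiding_lists_def)
  then have "\<forall>b\<in>\<Phi>. \<not> (\<exists>k::int. b \<bullet> lattice_vector xs = real q * of_int k)"
    using lattice_vector_regular_iff xs(1) by blast
  moreover have "lattice_vector xs \<in> Z" by (auto simp: coweight_lattice_coords coord_lattice_vector)
  ultimately show "t \<in> regular_cosets \<Phi> q" using xs(2) by (simp add: regular_cosets_def)
qed

lemma lattice_vector_coset_inj:
  "inj_on (\<lambda>xs. coset_mod Z q (lattice_vector xs)) (regular_lists q l)"
proof (rule inj_onI)
  fix xs ys
  assume xs: "xs \<in> regular_lists q l" and ys: "ys \<in> regular_lists q l"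
    and eq: "coset_mod Z q (lattice_vector xs) = coset_mod Z q (lattice_vector ys)"
  have len: "length xs = l" "length ys = l" using xs ys by (auto simp: avoiding_lists_def)
  show "xs = ys"
  proof (rule nth_equalityI)
    fix i assume "i < length xs"
    then have i: "i < l" using len by simp
    have "xs ! i \<in> set xs" "ys ! i \<in> set ys" using i len by auto
    then have "xs ! i \<in> {1..<q}" "ys ! i \<in> {1..<q}"
      using xs ys unfolding avoiding_lists_def by blast+
    then have "\<bar>int (ys ! i) - int (xs ! i)\<bar> < int q" by auto
    moreover have Si: "Suc i \<in> {1..l}" using i by simp
    then have "\<exists>m::int. e (Suc i) \<bullet> lattice_vector ys - e (Suc i) \<bullet> lattice_vector xs = real q * of_int m"
      using eq unfolding coset_eq_iff_coords by blast
    then have "\<exists>m::int. real (ys ! i) - real (xs ! i) = real q * of_int m"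
      unfolding coord_lattice_vector[OF Si] by simp
    then have "int q dvd int (ys ! i) - int (xs ! i)"
      using multiple_iff_dvd[of "real (ys ! i) - real (xs ! i)" "int (ys ! i) - int (xs ! i)"] by simp
    ultimately show "xs ! i = ys ! i"
      using dvd_imp_le_int[of "int (ys ! i) - int (xs ! i)" "int q"]
      by (cases "ys ! i = xs ! i") auto
  qed (use len in simp)
qed

lemma char_count_eq:
  assumes "w \<in> signed_perms" "q > 0"
  shows "char_count \<Phi> q w = card {xs \<in> regular_lists q l.
    coset_mod Z q (w (lattice_vector xs)) = coset_mod Z q (lattice_vector xs)}"
proof -
  let ?c = "\<lambda>xs. coset_mod Z q (lattice_vector xs)"
  let ?L = "{xs \<in> regular_lists q l. coset_mod Z q (w (lattice_vector xs)) = ?c xs}"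
  have "{t \<in> regular_cosets \<Phi> q. w ` t = t} = ?c ` ?L"
    unfolding regular_cosets_eq[OF assms(2)] using signed_perm_coset[OF assms(1)] by auto
  moreover have "inj_on ?c ?L" by (rule inj_on_subset[OF lattice_vector_coset_inj]) auto
  ultimately show ?thesis by (simp add: char_count_def card_image)
qed

lemma char_count_id:
  assumes "q > 0"
  shows "char_count \<Phi> q id = card (regular_lists q l)"
  using char_count_eq[OF signed_perm_id assms] by simp

lemma char_count_reflection_e1:
  assumes "q > 0"
  shows "char_count \<Phi> q (reflection (e 1)) = card {xs \<in> regular_lists q l. 2 * hd xs = q}"
proof -
  have "coset_mod Z q (reflection (e 1) (lattice_vector xs)) = coset_mod Z q (lattice_vector xs)
      \<longleftrightarrow> 2 * hd xs = q" if xs: "xs \<in> regular_lists q l" for xs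
  proof -
    have "xs \<noteq> []" using xs rank by (auto simp: avoiding_lists_def)
    then have hd: "xs ! 0 = hd xs" "hd xs \<in> {1..<q}"
      using xs hd_in_set[of xs] unfolding avoiding_lists_def by (simp add: hd_conv_nth, blast)
    have "(\<exists>m::int. e k \<bullet> lattice_vector xs - e k \<bullet> reflection (e 1) (lattice_vector xs) = real q * of_int m)
        \<longleftrightarrow> (k = 1 \<longrightarrow> int q dvd int (2 * hd xs))" if k: "k \<in> {1..l}" for k
    proof (cases "k = 1")
      case True
      then have "e k \<bullet> lattice_vector xs - e k \<bullet> reflection (e 1) (lattice_vector xs)
          = of_int (int (2 * hd xs))"
        using k coord_reflection_e1[OF k] coord_lattice_vector[OF k] hd by simp
      from multiple_iff_dvd[OF this] show ?thesis using True by blast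
    next
      case False
      then show ?thesis using coord_reflection_e1[OF k] by (auto intro: exI[of _ 0])
    qed
    then have "coset_mod Z q (reflection (e 1) (lattice_vector xs)) = coset_mod Z q (lattice_vector xs)
        \<longleftrightarrow> q dvd 2 * hd xs"
      using rank unfolding coset_eq_iff_coords of_nat_dvd_iff by auto
    also have "\<dots> \<longleftrightarrow> 2 * hd xs = q"
    proof
      assume "q dvd 2 * hd xs"
      then obtain c where c: "2 * hd xs = q * c" by blast
      have "0 < 2 * hd xs" "2 * hd xs < q * 2" using hd(2) by auto
      then have "c = 1" unfolding c by auto
      then show "2 * hd xs = q" using c by simp
    qed auto
    finally show ?thesis .
  qed
  then show ?thesis
    unfolding char_count_eq[OF reflection_e1_signed_perm assms] by (metis (no_types, lifting) Collect_cong)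
qed

end

theorem theorem5p3:
  fixes e :: "nat \<Rightarrow> 'a::euclidean_space" and l q :: nat
  assumes basis: "bij_betw e {1..l} (Basis :: 'a set)"
    and l: "l \<ge> 2"
    and q: "q > 0"
  shows "alcove_stabilizer (B_roots e l) (B_simple e l) l
           = {id, omega (B_roots e l) (B_simple e l) l 1}
    \<and> (\<forall>w \<in> alcove_stabilizer (B_roots e l) (B_simple e l) l.
        (w = id \<and> odd q \<longrightarrow>
           int (char_count (B_roots e l) q w) = (\<Prod>k=1..l. int q - (2 * int k - 1))) \<and>
        (w = id \<and> even q \<longrightarrow>
           int (char_count (B_roots e l) q w)
             = (\<Prod>k=1..l-1. int q - 2 * int k) * (int q - int l)) \<and>
        (w = omega (B_roots e l) (B_simple e l) l 1 \<and> odd q \<longrightarrow>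
           int (char_count (B_roots e l) q w) = 0) \<and>
        (w = omega (B_roots e l) (B_simple e l) l 1 \<and> even q \<longrightarrow>
           int (char_count (B_roots e l) q w) = (\<Prod>k=1..l-1. int q - 2 * int k)))"
proof -
  interpret type_B e l using basis l by unfold_locales
  have id_odd: "int (char_count (B_roots e l) q id) = (\<Prod>k=1..l. int q - (2 * int k - 1))" if "odd q"
    using char_count_id[OF q] card_regular_lists_odd[OF that] by (simp only:)
  have id_even: "int (char_count (B_roots e l) q id)
      = (\<Prod>k=1..l-1. int q - 2 * int k) * (int q - int l)" if "even q"
    using char_count_id[OF q] card_regular_lists_even[OF that q, of l] l by simp
  have refl_odd: "int (char_count (B_roots e l) q (reflection (e 1))) = 0" if "odd q"
  proof -
    have "{xs \<in> regular_lists q l. 2 * hd xs = q} = {}" using that by auto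
    then show ?thesis unfolding char_count_reflection_e1[OF q] by (simp only: card.empty of_nat_0)
  qed
  have refl_even: "int (char_count (B_roots e l) q (reflection (e 1)))
      = (\<Prod>k=1..l-1. int q - 2 * int k)" if "even q"
    using char_count_reflection_e1[OF q] card_regular_lists_half[OF that q, of "l - 1"] l by simp
  show ?thesis
    unfolding omega_1 alcove_stabilizer_eq using id_odd id_even refl_odd refl_even by blast
qed

end
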